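(* The price of anarchy, with respect to liquid welfare, of NOB-feasible coarse correlated equilibria in generalized second-price (GSP) auctions with budgets is at most $|\mathcal W_{-1}(-e^{-2})|\approx3.146$. That is, for every such instance $I$ and every NOB-feasible coarse correlated equilibrium $A$ of $I$, $\mathrm{OPT}(I)\le|\mathcal W_{-1}(-e^{-2})|\cdot\mathrm{LW}(I,A)$.
   Context: $\mathcal W_{-1}$ is the lower real branch of the Lambert function: $\mathcal W_{-1}(-e^{-2})$ is the unique $w\in(-\infty,-1]$ with $we^w=-e^{-2}$. GSP auction: bidders $N=[n]$, $n\ge2$, and $m\le n$ slots with click-through rates $\alpha_1\ge\alpha_2\ge\dots\ge\alpha_m>0$; set $\alpha_0=0$. Bidder $i$ submits a scalar bid $a_i\in\mathcal A_i=\mathbb R_{\ge0}$; $\mathcal A=\mathbb R_{\ge0}^n$. Bidders are ranked in non-increasing order of bids, ties resolved by a fixed deterministic rule, and slot $j\in[m]$ goes to the $j$-th ranked bidder; $X_i(a)\in\{0,1,\dots,m\}$ is the slot of bidder $i$ ($0$ meaning no slot). Let $\beta_j(a)$ be the $j$-th highest bid, with $\beta_{n+1}(a)=0$. Bidder $i$ pays $P_i(a)=\alpha_{X_i(a)}\beta_{X_i(a)+1}(a)$. Bidder $i$ has a value per click $\bar v_i\ge0$, giving valuation $v_i(j)=\bar v_i\alpha_j$, and a budget $B_i\in(0,\infty]$. Utility: $u_i(a)=v_i(X_i(a))-P_i(a)$. Feasible allocations $\mathcal X$: profiles $x\in\{0,\dots,m\}^n$ in which no slot $j\ge1$ is assigned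 to two bidders. $\Delta(S)$ denotes probability distributions on $S$. For $A\in\Delta(\mathcal A)$ let $A_{-i}$ be the marginal on the others' actions, and let $\mathcal C_i(A_{-i})$ be the set of $A_i'\in\Delta(\mathcal A_i)$ with $\mathbb E_{a_i'\sim A_i',a_{-i}\sim A_{-i}}[P_i(a_i',a_{-i})]\le B_i$ (independent draws). $A\in\Delta(\mathcal A)$ is a coarse correlated equilibrium if for all $i$: $\mathbb E_{a\sim A}[P_i(a)]\le B_i$, and $\mathbb E_{a\sim A}[u_i(a)]\ge\mathbb E_{a_i'\sim A_i',a_{-i}\sim A_{-i}}[u_i(a_i',a_{-i})]$ for all $A_i'\in\mathcal C_i(A_{-i})$. $\mathrm{LW}(I,A)=\sum_i\min\{\mathbb E_{a\sim A}[v_i(X_i(a))],B_i\}$ and $\mathrm{OPT}(I)=\max_{\chi\in\Delta(\mathcal X)}\sum_i\min\{\mathbb E_{x\sim\chi}[v_i(x_i)],B_i\}$. The price of anarchy is the supremum of $\mathrm{OPT}(I)/\mathrm{LW}(I,A)$ over instances $I$ and equilibria $A$. NOB (no overbidding): let $W_i(a)=\sup\{P_i(a_i,a_{-i}'):X_i(a_i,a_{-i}')=X_i(a)\}$. $A$ is NOB-feasible if $\sum_i\mathbb E_{a\sim A}[W_i(a)]\le\mathrm{LW}(I,A)$. Deviations are not restricted by NOB. *)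

theory Defs
  imports "HOL-Probability.Probability"
begin

definition lambert_Wm1 :: "real \<Rightarrow> real" where
  "lambert_Wm1 x = (THE w. w \<le> -1 \<and> w * exp w = x)"

text \<open>Expectation of a real function as a value in $[-\infty,\infty]$, so that payments with
  infinite mean (and hence utilities with mean $-\infty$) are not silently given the value 0.
  It is used only where the positive part has finite mean or the function is non-negative.\<close>

definition expect :: "'a measure \<Rightarrow> ('a \<Rightarrow> real) \<Rightarrow> ereal" where
  "expect M f = enn2ereal (\<integral>\<^sup>+ x. ennreal (f x) \<partial>M) - enn2ereal (\<integral>\<^sup>+ x. ennreal (- f x) \<partial>M)"

text \<open>Bidders are \<open>1, \<dots>, n\<close>, slots are \<open>1, \<dots>, m\<close>, and slot \<open>0\<close> means no slot. The term
  \<open>ranking I a j\<close> is the bidder ranked \<open>j\<close>-th at the bid profile \<open>a\<close>; it carries the tie-breaking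
  rule.\<close>

record gsp =
  num_bidders :: nat
  num_slots :: nat
  ctr :: "nat \<Rightarrow> real"
  click_value :: "nat \<Rightarrow> real"
  budget :: "nat \<Rightarrow> ereal"
  ranking :: "(nat \<Rightarrow> real) \<Rightarrow> nat \<Rightarrow> nat"

definition bidders :: "gsp \<Rightarrow> nat set" where
  "bidders I = {1..num_bidders I}"

definition bid_space :: "real measure" where
  "bid_space = restrict_space borel {0..}"

definition profile_space :: "nat set \<Rightarrow> (nat \<Rightarrow> real) measure" where
  "profile_space J = PiM J (\<lambda>_. bid_space)"

definition distributions :: "'a measure \<Rightarrow> 'a measure set" where
  "distributions S = {M. prob_space M \<and> sets M = sets S}"

text \<open>The tie-breaking rule is an arbitrary Borel function of the bids (every fixed priority order
  among the bidders is an example); measurability makes the expectations below meaningful.\<close>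

definition valid_ranking :: "gsp \<Rightarrow> bool" where
  "valid_ranking I \<longleftrightarrow>
     (\<forall>a \<in> space (profile_space (bidders I)).
        bij_betw (ranking I a) {1..num_bidders I} (bidders I) \<and>
        (\<forall>j k. 1 \<le> j \<and> j \<le> k \<and> k \<le> num_bidders I \<longrightarrow>
           a (ranking I a k) \<le> a (ranking I a j))) \<and>
     (\<forall>j \<in> {1..num_bidders I}.
        (\<lambda>a. ranking I a j) \<in> measurable (profile_space (bidders I)) (count_space UNIV))"

definition gsp_instance :: "gsp \<Rightarrow> bool" where
  "gsp_instance I \<longleftrightarrow>
     2 \<le> num_bidders I \<and> num_slots I \<le> num_bidders I \<and>
     ctr I 0 = 0 \<and>
     (\<forall>j \<in> {1..num_slots I}. 0 < ctr I j) \<and>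
     (\<forall>j k. 1 \<le> j \<and> j \<le> k \<and> k \<le> num_slots I \<longrightarrow> ctr I k \<le> ctr I j) \<and>
     (\<forall>i \<in> bidders I. 0 \<le> click_value I i) \<and>
     (\<forall>i \<in> bidders I. 0 < budget I i) \<and>
     valid_ranking I"

definition slot_of :: "gsp \<Rightarrow> nat \<Rightarrow> (nat \<Rightarrow> real) \<Rightarrow> nat" where
  "slot_of I i a =
     (if \<exists>j \<in> {1..num_slots I}. ranking I a j = i
      then THE j. j \<in> {1..num_slots I} \<and> ranking I a j = i
      else 0)"

definition highest_bid :: "gsp \<Rightarrow> nat \<Rightarrow> (nat \<Rightarrow> real) \<Rightarrow> real" where
  "highest_bid I j a =
     (if j \<in> {1..num_bidders I}
      then rev (sort (map a [1..<Suc (num_bidders I)])) ! (j - 1)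
      else 0)"

definition payment :: "gsp \<Rightarrow> nat \<Rightarrow> (nat \<Rightarrow> real) \<Rightarrow> real" where
  "payment I i a = ctr I (slot_of I i a) * highest_bid I (slot_of I i a + 1) a"

definition valuation :: "gsp \<Rightarrow> nat \<Rightarrow> nat \<Rightarrow> real" where
  "valuation I i j = click_value I i * ctr I j"

definition utility :: "gsp \<Rightarrow> nat \<Rightarrow> (nat \<Rightarrow> real) \<Rightarrow> real" where
  "utility I i a = valuation I i (slot_of I i a) - payment I i a"

definition marginal_others :: "gsp \<Rightarrow> nat \<Rightarrow> (nat \<Rightarrow> real) measure \<Rightarrow> (nat \<Rightarrow> real) measure" where
  "marginal_others I i A =
     distr A (profile_space (bidders I - {i})) (\<lambda>a. restrict a (bidders I - {i}))"

definition expect_dev ::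
    "gsp \<Rightarrow> nat \<Rightarrow> (nat \<Rightarrow> real) measure \<Rightarrow> real measure \<Rightarrow> ((nat \<Rightarrow> real) \<Rightarrow> real) \<Rightarrow> ereal" where
  "expect_dev I i A D f = expect (D \<Otimes>\<^sub>M marginal_others I i A) (\<lambda>(b, a). f (a(i := b)))"

definition feasible_deviations ::
    "gsp \<Rightarrow> nat \<Rightarrow> (nat \<Rightarrow> real) measure \<Rightarrow> real measure set" where
  "feasible_deviations I i A =
     {D \<in> distributions bid_space. expect_dev I i A D (payment I i) \<le> budget I i}"

definition coarse_correlated_equilibrium :: "gsp \<Rightarrow> (nat \<Rightarrow> real) measure \<Rightarrow> bool" where
  "coarse_correlated_equilibrium I A \<longleftrightarrow>
     A \<in> distributions (profile_space (bidders I)) \<and>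
     (\<forall>i \<in> bidders I.
        expect A (payment I i) \<le> budget I i \<and>
        (\<forall>D \<in> feasible_deviations I i A. expect_dev I i A D (utility I i) \<le> expect A (utility I i)))"

definition liquid_welfare :: "gsp \<Rightarrow> (nat \<Rightarrow> real) measure \<Rightarrow> ereal" where
  "liquid_welfare I A =
     (\<Sum>i \<in> bidders I. min (expect A (\<lambda>a. valuation I i (slot_of I i a))) (budget I i))"

definition feasible_allocations :: "gsp \<Rightarrow> (nat \<Rightarrow> nat) set" where
  "feasible_allocations I =
     {x \<in> bidders I \<rightarrow>\<^sub>E {0..num_slots I}.
        \<forall>i \<in> bidders I. \<forall>k \<in> bidders I. i \<noteq> k \<and> x i = x k \<longrightarrow> x i = 0}"

definition opt_liquid_welfare :: "gsp \<Rightarrow> ereal" where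
  "opt_liquid_welfare I =
     (SUP p \<in> {p. set_pmf p \<subseteq> feasible_allocations I}.
        \<Sum>i \<in> bidders I. min (expect (measure_pmf p) (\<lambda>x. valuation I i (x i))) (budget I i))"

text \<open>The real supremum below is over a non-empty set bounded by
  \<open>ctr I (slot_of I i a) * a i\<close>.\<close>

definition willingness :: "gsp \<Rightarrow> nat \<Rightarrow> (nat \<Rightarrow> real) \<Rightarrow> real" where
  "willingness I i a =
     Sup {payment I i (a'(i := a i)) | a'.
            a' \<in> space (profile_space (bidders I - {i})) \<and>
            slot_of I i (a'(i := a i)) = slot_of I i a}"

definition nob_feasible :: "gsp \<Rightarrow> (nat \<Rightarrow> real) measure \<Rightarrow> bool" where
  "nob_feasible I A \<longleftrightarrow> (\<Sum>i \<in> bidders I. expect A (willingness I i)) \<le> liquid_welfare I A"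

text \<open>In \<^typ>\<open>ereal\<close>, \<open>0 / 0 = 0\<close> and \<open>x / 0 = \<infinity>\<close> for \<open>x > 0\<close>, so an equilibrium with zero liquid
  welfare counts exactly when the optimum is positive.\<close>

definition gsp_price_of_anarchy :: ereal where
  "gsp_price_of_anarchy =
     Sup {opt_liquid_welfare I / liquid_welfare I A | I A.
            gsp_instance I \<and> coarse_correlated_equilibrium I A \<and> nob_feasible I A}"

end

theory Submission imports Defs begin

text \<open>
  Fix a bidder with value per click \<open>v\<close>, target slots drawn with probabilities \<open>c j\<close>, and suppose
  the resulting expected value \<open>v * e\<close>, with \<open>e\<close> the expected click-through rate, is within the
  budget. A bid \<open>b\<close> above the \<open>j\<close>-th highest bid \<open>\<tau>\<close> wins slot \<open>j\<close> or a better one, at a price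
  of at most \<open>b\<close> per click. A better slot may cost too much, so the deviation submits
  \<open>b\<close> only with the probability that cuts its expected clicks down to at most \<open>e\<close> and bids \<open>0\<close>
  otherwise: it then costs at most \<open>b * e \<le> v * e\<close> for every \<open>b \<le> v\<close>. The equilibrium value of the
  bidder is thus at least \<open>(v - b) * (\<Sum>j. c j * ctr j * P(\<tau> < b))\<close> for all such \<open>b\<close>.

  Dividing by \<open>v - b\<close> and integrating \<open>b\<close> over \<open>[0, (1 - 1/\<Lambda>) v]\<close> bounds \<open>ln \<Lambda>\<close> times the value
  below by \<open>(1 - 1/\<Lambda>) v e\<close> minus the expected price of the target slots. Each slot is
  targeted with total probability at most one, and the bids weighted by click-through rates are
  willingnesses to pay, so without overbidding the prices add up to at most the liquid welfare.
  Hence \<open>(1 - 1/\<Lambda>) OPT \<le> (1 + ln \<Lambda>) LW\<close>. The constant is best when \<open>ln \<Lambda> = \<Lambda> - 2\<close>, that is, when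
  \<open>- \<Lambda> * exp (- \<Lambda>) = - exp (- 2)\<close>, and then equals \<open>\<Lambda>\<close>.
\<close>

section \<open>The Lambert constant and its numerical value\<close>

text \<open>The derivative \<open>(1 + x) * exp x\<close> is negative for \<open>x < -1\<close>, so
  \<open>x * exp x\<close> is strictly decreasing on the half-line up to \<open>-1\<close>. This
  gives the uniqueness that the description operator asks for.\<close>

lemma lambert_Wm1_eq:
  assumes "w \<le> -1" "w * exp w = x"
  shows "lambert_Wm1 x = w"
proof -
  have less: "u * exp u > w * exp w" if "u < w" "w \<le> -1" for u w :: real
  proof (rule DERIV_neg_imp_decreasing_open[OF \<open>u < w\<close>])
    show "\<exists>y. ((\<lambda>x. x * exp x) has_real_derivative y) (at z) \<and> y < 0" if "u < z" "z < w" for z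
    proof (intro exI conjI)
      show "((\<lambda>x. x * exp x) has_real_derivative (1 + z) * exp z) (at z)"
        by (auto intro!: derivative_eq_intros simp: algebra_simps)
      show "(1 + z) * exp z < 0"
        using that \<open>w \<le> -1\<close> by (simp add: mult_less_0_iff)
    qed
  qed (auto intro!: continuous_intros)
  show ?thesis
    unfolding lambert_Wm1_def
  proof (rule the_equality)
    show "u = w" if "u \<le> -1 \<and> u * exp u = x" for u
      using less[of u w] less[of w u] that assms by (cases u w rule: linorder_cases) auto
  qed (use assms in auto)
qed

text \<open>For even \<open>N\<close> the Lagrange remainder contains an even power of
  \<open>x\<close>, so it is nonnegative for either sign of \<open>x\<close>.\<close>

lemma exp_ge_partial_sum:
  assumes "even N"
  shows "(\<Sum>k<N. x ^ k / fact k) \<le> exp (x :: real)"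
proof -
  obtain t where "exp x = (\<Sum>k<N. x ^ k / fact k) + exp t / fact N * x ^ N"
    using Maclaurin_exp_le[of x N] by blast
  moreover have "0 \<le> exp t / fact N * x ^ N"
    using assms by (simp add: zero_le_even_power)
  ultimately show ?thesis by linarith
qed

text \<open>\<Lambda> is a root of \<open>x - 2 - ln x\<close>, found by the intermediate value
  theorem on the interval of numbers that round to 3.146. Exponentiating the root equation gives
  \<open>\<Lambda> * exp (- \<Lambda>) = exp (- 2)\<close>.\<close>

lemma lambert_Wm1_bounds:
  obtains \<Lambda> where "lambert_Wm1 (- exp (- 2)) = - \<Lambda>" "3.1455 \<le> \<Lambda>" "\<Lambda> \<le> 3.1465" "ln \<Lambda> = \<Lambda> - 2"
proof -
  define f where "f x = x - 2 - ln x" for x :: real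
  \<comment> \<open>Partial sums only bound \<open>exp\<close> from below, so the upper bound on
    \<open>exp 1.1455\<close> is obtained from its reciprocal. Here
    \<open>1.1455 = 3.1455 - 2\<close>.\<close>
  have "1 / 3.1455 \<le> (\<Sum>k<10. (-1.1455 :: real) ^ k / fact k)"
    by (simp add: lessThan_nat_numeral eval_nat_numeral fact_numeral)
  also have "\<dots> \<le> exp (-1.1455)" by (rule exp_ge_partial_sum) simp
  finally have "exp 1.1455 \<le> (3.1455 :: real)"
    by (simp add: exp_minus field_simps)
  then have "1.1455 \<le> ln (3.1455 :: real)"
    by (subst ln_ge_iff) simp_all
  then have "f 3.1455 \<le> 0"
    by (simp add: f_def)
  moreover have "(3.1465 :: real) \<le> (\<Sum>k<10. 1.1465 ^ k / fact k)"
    by (simp add: lessThan_nat_numeral eval_nat_numeral fact_numeral)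
  then have "(3.1465 :: real) \<le> exp 1.1465"
    using exp_ge_partial_sum[of 10 "1.1465"] by simp
  then have "0 \<le> f 3.1465"
    using ln_le_cancel_iff[of "3.1465" "exp 1.1465"] by (simp add: f_def)
  moreover have "continuous_on {3.1455..3.1465} f"
    unfolding f_def by (intro continuous_intros) auto
  ultimately have "\<exists>\<Lambda>\<ge>3.1455. \<Lambda> \<le> 3.1465 \<and> f \<Lambda> = 0"
    by (intro IVT') auto
  then obtain \<Lambda> where \<Lambda>: "3.1455 \<le> \<Lambda>" "\<Lambda> \<le> 3.1465" "f \<Lambda> = 0"
    by blast
  then have "ln \<Lambda> = \<Lambda> - 2" by (simp add: f_def)
  moreover have "- \<Lambda> * exp (- \<Lambda>) = - exp (-2)"
  proof -
    have "\<Lambda> = exp (ln \<Lambda>)" using \<Lambda> by simp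
    also have "ln \<Lambda> = \<Lambda> - 2" by fact
    finally have "\<Lambda> * exp (- \<Lambda>) = exp (\<Lambda> - 2) * exp (- \<Lambda>)" by simp
    also have "\<dots> = exp (-2)" by (simp flip: exp_add)
    finally show ?thesis by simp
  qed
  ultimately show ?thesis
    using that[of \<Lambda>] \<Lambda> lambert_Wm1_eq[of "- \<Lambda>"] by auto
qed

section \<open>Extended expectations and integration over the bid level\<close>

lemma expect_mono:
  assumes "\<And>x. x \<in> space M \<Longrightarrow> f x \<le> g x"
  shows "expect M f \<le> expect M g"
  unfolding expect_def
  by (intro ereal_minus_mono) (auto intro!: nn_integral_mono ennreal_leI assms simp: less_eq_ennreal.rep_eq[symmetric])

lemma expect_nonneg_eq:
  assumes "\<And>x. x \<in> space M \<Longrightarrow> 0 \<le> f x"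
  shows "expect M f = enn2ereal (\<integral>\<^sup>+x. ennreal (f x) \<partial>M)"
proof -
  have "(\<integral>\<^sup>+x. ennreal (- f x) \<partial>M) = (\<integral>\<^sup>+x. 0 \<partial>M)"
    using assms by (intro nn_integral_cong) (auto intro: ennreal_neg)
  then show ?thesis by (simp add: expect_def zero_ennreal.rep_eq)
qed

lemma expect_eq_integral:
  assumes "integrable M f" "\<And>x. x \<in> space M \<Longrightarrow> 0 \<le> f x"
  shows "expect M f = ereal (\<integral>x. f x \<partial>M)"
  using assms
  by (subst expect_nonneg_eq) (auto simp: nn_integral_eq_integral AE_I2 integral_nonneg)

text \<open>Tonelli: for fixed \<open>x\<close>, the levels \<open>b\<close> in
  \<open>{0..T}\<close> above \<open>X x\<close> form an interval of length \<open>T - X x\<close>,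
  empty if \<open>X x\<close> exceeds \<open>T\<close>. The coercion \<open>ennreal\<close> supplies
  this truncation at 0.\<close>

lemma nn_integral_measure_less:
  fixes X :: "'a \<Rightarrow> real"
  assumes "prob_space M" and [measurable]: "X \<in> borel_measurable M"
    and nonneg: "\<And>x. x \<in> space M \<Longrightarrow> 0 \<le> X x"
  shows "(\<integral>\<^sup>+b. ennreal (measure M {x \<in> space M. X x < b}) * indicator {0..T} b \<partial>lborel) =
         (\<integral>\<^sup>+x. ennreal (T - X x) \<partial>M)"
proof -
  interpret prob_space M by fact
  interpret pair_sigma_finite M lborel ..
  have "(\<integral>\<^sup>+b. ennreal (prob {x \<in> space M. X x < b}) * indicator {0..T} b \<partial>lborel) =
      (\<integral>\<^sup>+b. \<integral>\<^sup>+x. indicator {0..T} b * (if X x < b then 1 else 0) \<partial>M \<partial>lborel)"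
  proof (intro nn_integral_cong)
    fix b :: real
    have "(\<integral>\<^sup>+x. indicator {0..T} b * (if X x < b then 1 else 0) \<partial>M) =
        indicator {0..T} b * (\<integral>\<^sup>+x. (if X x < b then 1 else 0) \<partial>M)"
      by (rule nn_integral_cmult) measurable
    also have "(\<integral>\<^sup>+x. (if X x < b then 1 else 0) \<partial>M) = (\<integral>\<^sup>+x. indicator {x \<in> space M. X x < b} x \<partial>M)"
      by (intro nn_integral_cong) (auto simp: indicator_def)
    also have "\<dots> = ennreal (prob {x \<in> space M. X x < b})"
      by (simp add: emeasure_eq_measure)
    finally show "ennreal (prob {x \<in> space M. X x < b}) * indicator {0..T} b =
      (\<integral>\<^sup>+x. indicator {0..T} b * (if X x < b then 1 else 0) \<partial>M)"
      by (simp add: mult.commute)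
  qed
  also have "\<dots> = (\<integral>\<^sup>+x. \<integral>\<^sup>+b. indicator {0..T} b * (if X x < b then 1 else 0) \<partial>lborel \<partial>M)"
    by (rule Fubini') measurable
  also have "\<dots> = (\<integral>\<^sup>+x. ennreal (T - X x) \<partial>M)"
  proof (intro nn_integral_cong)
    fix x assume "x \<in> space M"
    then have "(\<integral>\<^sup>+b. indicator {0..T} b * (if X x < b then 1 else 0) \<partial>lborel) =
        (\<integral>\<^sup>+b. indicator {X x<..T} b \<partial>lborel)"
      using nonneg[of x] by (intro nn_integral_cong) (simp add: indicator_def)
    also have "\<dots> = ennreal (T - X x)"
      by (cases "X x \<le> T") (auto simp: ennreal_neg)
    finally show "(\<integral>\<^sup>+b. indicator {0..T} b * (if X x < b then 1 else 0) \<partial>lborel) = ennreal (T - X x)" .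
  qed
  finally show ?thesis .
qed

text \<open>Divide the bound by \<open>v - b\<close> and integrate over \<open>b\<close> in
  \<open>{0..T}\<close>. The right side becomes the logarithm; on the left,
  \<open>nn_integral_measure_less\<close> gives the means of the positive parts of
  \<open>T - X j\<close>.\<close>

lemma sum_expectation_le_of_pointwise_bound:
  fixes X :: "'j \<Rightarrow> 'a \<Rightarrow> real"
  assumes M: "prob_space M"
    and X: "\<And>j. j \<in> K \<Longrightarrow> integrable M (X j)" "\<And>j x. j \<in> K \<Longrightarrow> x \<in> space M \<Longrightarrow> 0 \<le> X j x"
    and w: "\<And>j. j \<in> K \<Longrightarrow> 0 \<le> w j"
    and T: "0 \<le> T" "T < v" and U: "0 \<le> U"
    and bound: "\<And>b. 0 \<le> b \<Longrightarrow> b \<le> T \<Longrightarrow>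
      (v - b) * (\<Sum>j\<in>K. w j * measure M {x \<in> space M. X j x < b}) \<le> U"
  shows "(\<Sum>j\<in>K. w j * (T - (\<integral>x. X j x \<partial>M))) \<le> U * ln (v / (v - T))"
proof -
  interpret prob_space M by fact
  interpret pair_sigma_finite M lborel ..
  note [measurable] = borel_measurable_integrable[OF X(1)]
  define p where "p j b = prob {x \<in> space M. X j x < b}" for j b
  have p_meas: "(\<lambda>b. ennreal (p j b)) \<in> borel_measurable lborel" if "j \<in> K" for j
  proof -
    have "mono (p j)"
      unfolding p_def using that by (auto intro!: monoI finite_measure_mono)
    then have "p j \<in> borel_measurable borel" by (rule borel_measurable_mono)
    then show ?thesis by simp
  qed
  \<comment> \<open>An antiderivative of \<open>U / (v - b)\<close> in \<open>b\<close>.\<close>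
  let ?F = "\<lambda>b. - U * ln (v - b)"
  have "(\<integral>\<^sup>+b. ennreal (U / (v - b)) * indicator {0..T} b \<partial>lborel) = ennreal (?F T - ?F 0)"
    using T U by (intro nn_integral_FTC_Icc)
      (auto intro!: derivative_eq_intros borel_measurable_divide simp: field_simps)
  also have "?F T - ?F 0 = U * ln (v / (v - T))"
    using T by (simp add: ln_div algebra_simps)
  finally have R: "(\<integral>\<^sup>+b. ennreal (U / (v - b)) * indicator {0..T} b \<partial>lborel) = ennreal (U * ln (v / (v - T)))" .
  have "(\<Sum>j\<in>K. ennreal (w j) * (\<integral>\<^sup>+x. ennreal (T - X j x) \<partial>M)) =
      (\<Sum>j\<in>K. ennreal (w j) * (\<integral>\<^sup>+b. ennreal (p j b) * indicator {0..T} b \<partial>lborel))"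
    unfolding p_def using X(2)
    by (intro sum.cong refl arg_cong2[where f = "(*)"] nn_integral_measure_less[symmetric] M) auto
  also have "\<dots> = (\<integral>\<^sup>+b. (\<Sum>j\<in>K. ennreal (w j) * (ennreal (p j b) * indicator {0..T} b)) \<partial>lborel)"
    using p_meas by (simp add: nn_integral_cmult nn_integral_sum)
  also have "\<dots> \<le> (\<integral>\<^sup>+b. ennreal (U / (v - b)) * indicator {0..T} b \<partial>lborel)"
  proof (intro nn_integral_mono)
    fix b
    have "(\<Sum>j\<in>K. w j * p j b) \<le> U / (v - b)" if "0 \<le> b" "b \<le> T"
      using bound[OF that] that T by (simp add: p_def pos_le_divide_eq mult.commute)
    moreover have "(\<Sum>j\<in>K. ennreal (w j) * ennreal (p j b)) = ennreal (\<Sum>j\<in>K. w j * p j b)"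
      using w by (simp add: p_def flip: ennreal_mult' sum_ennreal)
    ultimately show "(\<Sum>j\<in>K. ennreal (w j) * (ennreal (p j b) * indicator {0..T} b))
      \<le> ennreal (U / (v - b)) * indicator {0..T} b"
      by (auto simp: indicator_def intro!: ennreal_leI)
  qed
  also note R
  finally have main: "(\<Sum>j\<in>K. ennreal (w j) * (\<integral>\<^sup>+x. ennreal (T - X j x) \<partial>M)) \<le> ennreal (U * ln (v / (v - T)))" .
  \<comment> \<open>\<open>e j\<close> is the mean of the positive part that \<open>ennreal\<close>
    leaves, and dominates the untruncated \<open>T - (\<integral>x. X j x \<partial>M)\<close> of
    the conclusion.\<close>
  define e where "e j = (\<integral>x. max 0 (T - X j x) \<partial>M)" for j
  have e: "(\<integral>\<^sup>+x. ennreal (T - X j x) \<partial>M) = ennreal (e j)" "T - (\<integral>x. X j x \<partial>M) \<le> e j" "0 \<le> e j"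
    if "j \<in> K" for j
  proof -
    have int: "integrable M (\<lambda>x. max 0 (T - X j x))"
      using X(1)[OF that] by (intro integrable_max) auto
    have "(\<integral>\<^sup>+x. ennreal (T - X j x) \<partial>M) = (\<integral>\<^sup>+x. ennreal (max 0 (T - X j x)) \<partial>M)"
      by (intro nn_integral_cong) (simp add: max_def ennreal_neg)
    also have "\<dots> = ennreal (e j)"
      unfolding e_def using int by (intro nn_integral_eq_integral) auto
    finally show "(\<integral>\<^sup>+x. ennreal (T - X j x) \<partial>M) = ennreal (e j)" .
    have "T - (\<integral>x. X j x \<partial>M) = (\<integral>x. T - X j x \<partial>M)"
      using X(1)[OF that] by (simp add: prob_space)
    also have "\<dots> \<le> e j"
      unfolding e_def using X(1)[OF that] int by (intro integral_mono) auto
    finally show "T - (\<integral>x. X j x \<partial>M) \<le> e j" .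
    show "0 \<le> e j" by (simp add: e_def)
  qed
  have "(\<Sum>j\<in>K. ennreal (w j) * (\<integral>\<^sup>+x. ennreal (T - X j x) \<partial>M)) = (\<Sum>j\<in>K. ennreal (w j * e j))"
    using w e by (intro sum.cong) (simp_all add: ennreal_mult)
  also have "\<dots> = ennreal (\<Sum>j\<in>K. w j * e j)"
    using w e by (intro sum_ennreal) simp
  finally have "(\<Sum>j\<in>K. w j * e j) \<le> U * ln (v / (v - T))"
    using main T U by (simp add: ennreal_le_iff)
  moreover have "(\<Sum>j\<in>K. w j * (T - (\<integral>x. X j x \<partial>M))) \<le> (\<Sum>j\<in>K. w j * e j)"
    using w e by (intro sum_mono mult_left_mono) auto
  ultimately show ?thesis by linarith
qed

section \<open>Deterministic properties of the auction: ranks, slots, payments, willingness\<close>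

lemma space_bid_space: "space bid_space = {0..}"
  by (simp add: bid_space_def space_restrict_space)

lemma space_profile_space: "space (profile_space K) = K \<rightarrow>\<^sub>E {0..}"
  by (simp add: profile_space_def space_PiM space_bid_space)

locale gsp_auction =
  fixes I :: gsp
  assumes valid: "gsp_instance I"
begin

abbreviation "n \<equiv> num_bidders I"
abbreviation "m \<equiv> num_slots I"
abbreviation "profiles \<equiv> space (profile_space (bidders I))"

lemma m_le_n: "m \<le> n" and ctr_0: "ctr I 0 = 0"
  using valid by (auto simp: gsp_instance_def)

lemma ctr_pos: "j \<in> {1..m} \<Longrightarrow> 0 < ctr I j"
  using valid by (auto simp: gsp_instance_def)

lemma ctr_nonneg: "j \<le> m \<Longrightarrow> 0 \<le> ctr I j"
  using ctr_pos[of j] ctr_0 by (cases "j = 0") auto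

lemma ctr_antimono: "1 \<le> j \<Longrightarrow> j \<le> k \<Longrightarrow> k \<le> m \<Longrightarrow> ctr I k \<le> ctr I j"
  using valid unfolding gsp_instance_def by blast

lemma click_value_nonneg: "i \<in> bidders I \<Longrightarrow> 0 \<le> click_value I i"
  using valid by (auto simp: gsp_instance_def)

lemma budget_pos: "i \<in> bidders I \<Longrightarrow> 0 < budget I i"
  using valid by (auto simp: gsp_instance_def)

lemma bid_nonneg: "a \<in> profiles \<Longrightarrow> i \<in> bidders I \<Longrightarrow> 0 \<le> a i"
  by (auto simp: space_profile_space)

lemma profiles_upd: "a \<in> profiles \<Longrightarrow> i \<in> bidders I \<Longrightarrow> 0 \<le> b \<Longrightarrow> a(i := b) \<in> profiles"
  by (auto simp: space_profile_space PiE_iff extensional_def)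

lemma ranking_bij: "a \<in> profiles \<Longrightarrow> bij_betw (ranking I a) {1..n} (bidders I)"
  using valid by (auto simp: gsp_instance_def valid_ranking_def)

lemma ranking_in: "a \<in> profiles \<Longrightarrow> j \<in> {1..n} \<Longrightarrow> ranking I a j \<in> bidders I"
  using ranking_bij bij_betwE by blast

lemma ranking_antimono:
  assumes "a \<in> profiles" "1 \<le> j" "j \<le> k" "k \<le> n"
  shows "a (ranking I a k) \<le> a (ranking I a j)"
  using valid assms unfolding gsp_instance_def valid_ranking_def by blast

lemma ranking_inj:
  assumes "a \<in> profiles" "j \<in> {1..n}" "k \<in> {1..n}" "ranking I a j = ranking I a k"
  shows "j = k"
  using ranking_bij[OF assms(1)] assms(2-4) by (metis bij_betw_imp_inj_on inj_onD)

lemma ranking_surj: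
  assumes "a \<in> profiles" "i \<in> bidders I"
  obtains j where "j \<in> {1..n}" "ranking I a j = i"
proof -
  have "i \<in> ranking I a ` {1..n}"
    using ranking_bij[OF assms(1)] assms(2) by (simp only: bij_betw_def)
  then show ?thesis using that by blast
qed

text \<open>Sorting knows nothing of tie-breaking. Listed by rank, the bids are a permutation of the
  bid list and already non-increasing, so they agree with the reversed sorted list, however ties are
  resolved.\<close>

lemma highest_bid_eq:
  assumes "a \<in> profiles" "j \<in> {1..n}"
  shows "highest_bid I j a = a (ranking I a j)"
proof -
  let ?ys = "map (\<lambda>j. a (ranking I a j)) [1..<Suc n]"
  have ranks: "image_mset (ranking I a) (mset_set {1..n}) = mset_set (bidders I)"
    using ranking_bij[OF assms(1)] image_mset_mset_set[of "ranking I a" "{1..n}"]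
    by (simp only: bij_betw_def)
  then have "image_mset a (mset_set (bidders I)) = image_mset (\<lambda>j. a (ranking I a j)) (mset_set {1..n})"
    by (simp add: multiset.map_comp comp_def flip: ranks)
  then have "mset (map a [1..<Suc n]) = mset (rev ?ys)"
    by (simp add: atLeastLessThanSuc_atLeastAtMost bidders_def del: upt_Suc)
  moreover have "sorted (rev ?ys)"
    by (auto simp: sorted_rev_iff_nth_mono simp del: upt_Suc
             intro!: ranking_antimono[OF assms(1)])
  ultimately have "sort (map a [1..<Suc n]) = rev ?ys"
    using properties_for_sort[of "rev ?ys" "map a [1..<Suc n]"] by simp
  moreover have "?ys ! (j - 1) = a (ranking I a ([1..<Suc n] ! (j - 1)))"
    using assms(2) by (intro nth_map) (auto simp del: upt_Suc)
  moreover have "[1..<Suc n] ! (j - 1) = j"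
    using assms(2) nth_upt[of 1 "j - 1" "Suc n"] by (simp del: upt_Suc)
  ultimately show ?thesis
    using assms(2) by (simp add: highest_bid_def del: upt_Suc)
qed

lemma slot_of_ranked:
  assumes "a \<in> profiles" "k \<in> {1..n}"
  shows "slot_of I (ranking I a k) a = (if k \<le> m then k else 0)"
proof -
  have *: "j \<in> {1..m} \<Longrightarrow> ranking I a j = ranking I a k \<longleftrightarrow> j = k" for j
    using ranking_inj[OF assms(1) _ assms(2), of j] m_le_n by auto
  show ?thesis
  proof (cases "k \<le> m")
    case True
    then have "(THE j. j \<in> {1..m} \<and> ranking I a j = ranking I a k) = k"
      using assms(2) * by (intro the_equality) auto
    then show ?thesis
      using True assms(2) by (auto simp: slot_of_def)
  next
    case False
    then show ?thesis
      using * by (auto simp: slot_of_def)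
  qed
qed

lemma slot_of_le:
  assumes "a \<in> profiles" "i \<in> bidders I"
  shows "slot_of I i a \<le> m"
proof -
  obtain k where "k \<in> {1..n}" "ranking I a k = i"
    using ranking_surj[OF assms] .
  then show ?thesis using slot_of_ranked[OF assms(1), of k] by auto
qed

lemma ctr_slot_nonneg: "a \<in> profiles \<Longrightarrow> i \<in> bidders I \<Longrightarrow> 0 \<le> ctr I (slot_of I i a)"
  using slot_of_le ctr_nonneg by blast

lemma highest_bid_nonneg: "a \<in> profiles \<Longrightarrow> 0 \<le> highest_bid I j a"
  using highest_bid_eq[of a j] bid_nonneg[OF _ ranking_in]
  by (cases "j \<in> {1..n}") (auto simp: highest_bid_def)

lemma payment_nonneg: "a \<in> profiles \<Longrightarrow> i \<in> bidders I \<Longrightarrow> 0 \<le> payment I i a"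
  by (simp add: payment_def ctr_slot_nonneg highest_bid_nonneg)

text \<open>The price per click is the bid one rank below. At the last rank it is the default 0 of
  \<open>highest_bid\<close>, and without a slot both sides vanish because
  \<open>ctr I 0 = 0\<close>.\<close>

lemma payment_le_bid:
  assumes "a \<in> profiles" "i \<in> bidders I"
  shows "payment I i a \<le> ctr I (slot_of I i a) * a i"
proof -
  obtain k where k: "k \<in> {1..n}" "ranking I a k = i"
    using ranking_surj[OF assms] .
  have slot: "slot_of I i a = (if k \<le> m then k else 0)"
    using slot_of_ranked[OF assms(1) k(1)] k(2) by simp
  have "highest_bid I (k + 1) a \<le> a i"
  proof (cases "k + 1 \<le> n")
    case True
    then show ?thesis
      using highest_bid_eq[OF assms(1), of "k + 1"] ranking_antimono[OF assms(1), of k "k + 1"] k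
      by simp
  next
    case False
    then show ?thesis
      using bid_nonneg[OF assms] by (simp add: highest_bid_def)
  qed
  then show ?thesis
    using ctr_nonneg[of k] by (auto simp: payment_def slot ctr_0 intro: mult_left_mono)
qed

text \<open>If there are as many slots as bidders, the last slot is free and any bid wins it.\<close>

definition threshold :: "nat \<Rightarrow> (nat \<Rightarrow> real) \<Rightarrow> real" where
  "threshold j a = (if j < n then a (ranking I a j) else 0)"

lemma threshold_nonneg: "a \<in> profiles \<Longrightarrow> 1 \<le> j \<Longrightarrow> 0 \<le> threshold j a"
  using bid_nonneg[OF _ ranking_in] by (auto simp: threshold_def)

text \<open>Counting: if the deviator were ranked below \<open>j\<close>, the new top
  \<open>j\<close> ranks would hold others bidding at least \<open>b\<close>. Their bids are
  unchanged and strictly exceed the old \<open>j\<close>-th bid, so these \<open>j\<close> bidders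
  would fit into \<open>j - 1\<close> old ranks. Strictness makes the tie-breaking rule
  irrelevant.\<close>

lemma slot_of_above_threshold:
  assumes a: "a \<in> profiles" and i: "i \<in> bidders I" and j: "j \<in> {1..m}"
    and b: "threshold j a < b"
  shows "slot_of I i (a(i := b)) \<in> {1..j}"
proof -
  define a' where "a' = a(i := b)"
  have "0 \<le> b" using threshold_nonneg[OF a, of j] j b by auto
  then have a': "a' \<in> profiles" unfolding a'_def using profiles_upd a i by blast
  obtain k where k: "k \<in> {1..n}" "ranking I a' k = i"
    using ranking_surj[OF a' i] .
  have "k \<le> j"
  proof (rule ccontr)
    assume "\<not> k \<le> j"
    then have jn: "j < n" using k by auto
    have "ranking I a' ` {1..j} \<subseteq> ranking I a ` {1..<j}"
    proof
      fix l assume "l \<in> ranking I a' ` {1..j}"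
      then obtain r where r: "r \<in> {1..j}" "l = ranking I a' r" by auto
      have ln: "l \<in> bidders I" using r jn ranking_in[OF a', of r] by auto
      have "l \<noteq> i" using ranking_inj[OF a', of r k] r k \<open>\<not> k \<le> j\<close> jn by auto
      moreover have "b \<le> a' l"
        using ranking_antimono[OF a', of r k] r k \<open>\<not> k \<le> j\<close> by (auto simp: a'_def)
      ultimately have "b \<le> a l" by (simp add: a'_def)
      then have "a (ranking I a j) < a l" using b jn by (simp add: threshold_def)
      moreover obtain r' where r': "r' \<in> {1..n}" "ranking I a r' = l"
        using ranking_surj[OF a ln] .
      ultimately have "r' < j"
        using ranking_antimono[OF a, of j r'] j by fastforce
      then show "l \<in> ranking I a ` {1..<j}" using r' by auto
    qed
    then have "card (ranking I a' ` {1..j}) \<le> card (ranking I a ` {1..<j})"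
      by (intro card_mono) auto
    also have "\<dots> \<le> j - 1" using card_image_le[of "{1..<j}" "ranking I a"] by simp
    also have "card (ranking I a' ` {1..j}) = j"
      using ranking_bij[OF a'] jn
      by (subst card_image) (auto simp: bij_betw_def intro: inj_on_subset)
    finally show False using j by auto
  qed
  then show ?thesis
    using slot_of_ranked[OF a' k(1)] k j by (auto simp: a'_def)
qed

text \<open>The others can bid so that \<open>i\<close> keeps its slot and pays a price per click
  arbitrarily close to its own bid. This takes a bidder ranked below \<open>i\<close>, whence
  \<open>k < n\<close>.\<close>

lemma willingness_ge:
  assumes a: "a \<in> profiles" and i: "i \<in> bidders I"
    and k: "k \<in> {1..n}" "ranking I a k = i"
  shows "0 \<le> willingness I i a"
    and "k \<le> m \<Longrightarrow> k < n \<Longrightarrow> ctr I k * a i \<le> willingness I i a"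
proof -
  let ?S = "{payment I i (a'(i := a i)) | a'.
            a' \<in> space (profile_space (bidders I - {i})) \<and>
            slot_of I i (a'(i := a i)) = slot_of I i a}"
  have upd: "a'(i := a i) \<in> profiles" if "a' \<in> space (profile_space (bidders I - {i}))" for a'
    using that i bid_nonneg[OF a i] by (auto simp: space_profile_space PiE_iff extensional_def)
  have bdd: "bdd_above ?S"
  proof (rule bdd_aboveI)
    fix y assume "y \<in> ?S"
    then show "y \<le> ctr I (slot_of I i a) * a i"
      using payment_le_bid[OF upd i] by fastforce
  qed
  have le: "payment I i (a'(i := a i)) \<le> willingness I i a"
    if "a' \<in> space (profile_space (bidders I - {i}))"
      "slot_of I i (a'(i := a i)) = slot_of I i a" for a'
    unfolding willingness_def using that bdd by (intro cSup_upper) auto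
  \<comment> \<open>The actual bids of the others are among the candidates, so the supremum is at
    least the actual payment.\<close>
  have "(restrict a (bidders I - {i}))(i := a i) = a"
    using a by (auto simp: space_profile_space PiE_iff extensional_def fun_eq_iff)
  then have "payment I i a \<le> willingness I i a"
    using le[of "restrict a (bidders I - {i})"] a
    by (auto simp: space_profile_space)
  with payment_nonneg[OF a i] show nonneg: "0 \<le> willingness I i a" by simp
  show "ctr I k * a i \<le> willingness I i a" if "k \<le> m" "k < n"
  proof -
    \<comment> \<open>A price equal to the bid itself would create a tie that might be resolved
      against \<open>i\<close>; strictly lower prices avoid it and are let tend to
      \<open>a i\<close> afterwards.\<close>
    have *: "ctr I k * y \<le> willingness I i a" if y: "0 \<le> y" "y < a i" for y
    proof -
      \<comment> \<open>Raising the bids ranked above \<open>i\<close> and setting those ranked below to \<open>y\<close> pins \<open>i\<close> to its slot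
        whatever the tie-breaking rule, at price \<open>y\<close> per click.\<close>
      define H where "H = ranking I a ` {1..<k}"
      have "H \<subseteq> bidders I" using ranking_in[OF a] k by (auto simp: H_def)
      moreover have "i \<notin> H"
      proof
        assume "i \<in> H"
        then obtain s where "s \<in> {1..<k}" "ranking I a s = i" by (auto simp: H_def)
        then show False using ranking_inj[OF a, of s k] k by auto
      qed
      moreover have "card H = k - 1"
        unfolding H_def using ranking_bij[OF a] k(1)
        by (subst card_image) (auto simp: bij_betw_def intro: inj_on_subset)
      ultimately have H: "H \<subseteq> bidders I" "i \<notin> H" and cardH: "card H = k - 1" by auto
      define a' where "a' = (\<lambda>l\<in>bidders I - {i}. if l \<in> H then a i + 1 else y)"
      define a'' where "a'' = a'(i := a i)"
      have a': "a' \<in> space (profile_space (bidders I - {i}))"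
        using y by (auto simp: a'_def space_profile_space)
      have a'': "a'' \<in> profiles" unfolding a''_def using upd a' by blast
      have val: "l \<in> bidders I \<Longrightarrow> a'' l = (if l = i then a i else if l \<in> H then a i + 1 else y)" for l
        by (auto simp: a''_def a'_def)
      obtain r where r: "r \<in> {1..n}" "ranking I a'' r = i" using ranking_surj[OF a'' i] .
      \<comment> \<open>The bidders ahead of \<open>i\<close> are exactly those of \<open>H\<close>,
        of which there are \<open>k - 1\<close>; this forces the rank of \<open>i\<close> to be
        \<open>k\<close>.\<close>
      have first: "ranking I a'' ` {1..<r} = H"
      proof (intro equalityI subsetI)
        fix l assume "l \<in> ranking I a'' ` {1..<r}"
        then obtain s where s: "s \<in> {1..<r}" "l = ranking I a'' s" by auto
        have "l \<noteq> i" using ranking_inj[OF a'', of s r] s r by auto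
        moreover have "a'' i \<le> a'' l" using ranking_antimono[OF a'', of s r] s r by auto
        moreover have "l \<in> bidders I" using ranking_in[OF a'', of s] s r by auto
        ultimately show "l \<in> H" using val[of l] val[OF i] y by (auto split: if_splits)
      next
        fix l assume l: "l \<in> H"
        then obtain s where s: "s \<in> {1..n}" "ranking I a'' s = l"
          using ranking_surj[OF a'', of l] H by blast
        have "a'' i < a'' l" using val[of l] val[OF i] l H by auto
        then have "s < r" using ranking_antimono[OF a'', of r s] s r by fastforce
        then show "l \<in> ranking I a'' ` {1..<r}" using s by auto
      qed
      have "card (ranking I a'' ` {1..<r}) = r - 1"
        using ranking_bij[OF a''] r
        by (subst card_image) (auto simp: bij_betw_def intro: inj_on_subset)
      then have rk: "r = k" using first cardH r k by auto
      let ?l = "ranking I a'' (k + 1)"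
      have l: "?l \<in> bidders I" using ranking_in[OF a'', of "k+1"] \<open>k < n\<close> by auto
      have "?l \<noteq> i" using ranking_inj[OF a'', of "k+1" k] rk r \<open>k < n\<close> by auto
      moreover have "?l \<notin> H"
      proof
        assume "?l \<in> H"
        then obtain s where "s \<in> {1..<k}" "ranking I a'' s = ?l"
          unfolding first[symmetric] rk by force
        then show False using ranking_inj[OF a'', of s "k+1"] \<open>k < n\<close> by auto
      qed
      ultimately have "a'' ?l = y" using val[OF l] by simp
      then have "highest_bid I (k + 1) a'' = y"
        using highest_bid_eq[OF a'', of "k+1"] \<open>k < n\<close> by simp
      moreover have "slot_of I i a'' = k" "slot_of I i a = k"
        using slot_of_ranked[OF a'' r(1)] slot_of_ranked[OF a k(1)] r k rk \<open>k \<le> m\<close> by auto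
      ultimately show ?thesis
        using le[OF a'] unfolding a''_def[symmetric] by (simp add: payment_def)
    qed
    show ?thesis
    proof (cases "a i = 0")
      case True
      then show ?thesis using nonneg by simp
    next
      case False
      then have "0 < a i" using bid_nonneg[OF a i] by simp
      have c: "0 < ctr I k" using ctr_pos k \<open>k \<le> m\<close> by auto
      have "a i \<le> willingness I i a / ctr I k"
        by (rule dense_le_bounded[OF \<open>0 < a i\<close>]) (use * c in \<open>auto simp: field_simps\<close>)
      then show ?thesis using c by (simp add: field_simps)
    qed
  qed
qed

section \<open>Measurability\<close>

lemma finite_bidders: "finite (bidders I)"
  by (simp add: bidders_def)

lemma measurable_bid: "(\<lambda>b. b) \<in> borel_measurable bid_space"
  unfolding bid_space_def by (rule measurable_restrict_space1) simp

lemma measurable_component: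
  assumes "i \<in> K"
  shows "(\<lambda>a. a i) \<in> borel_measurable (profile_space K)"
  using measurable_compose[OF measurable_component_singleton[OF assms] measurable_bid]
  unfolding profile_space_def .

lemma measurable_ranking:
  "j \<in> {1..n} \<Longrightarrow> (\<lambda>a. ranking I a j) \<in> measurable (profile_space (bidders I)) (count_space UNIV)"
  using valid by (auto simp: gsp_instance_def valid_ranking_def)

text \<open>Splitting by the slot held avoids the description operator in \<open>slot_of\<close>:
  measurability and boundedness can be read off a finite sum over the measurable ranks.\<close>

lemma ctr_slot_eq:
  assumes "a \<in> profiles" "i \<in> bidders I"
  shows "ctr I (slot_of I i a) = (\<Sum>j\<in>{1..m}. if ranking I a j = i then ctr I j else 0)"
proof -
  obtain k where k: "k \<in> {1..n}" "ranking I a k = i"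
    using ranking_surj[OF assms] .
  have "(\<Sum>j\<in>{1..m}. if ranking I a j = i then ctr I j else 0) =
      (\<Sum>j\<in>{1..m}. if j = k then ctr I j else 0)"
  proof (intro sum.cong refl)
    fix j assume "j \<in> {1..m}"
    then have "ranking I a j = i \<longleftrightarrow> j = k"
      using ranking_inj[OF assms(1), of j k] k m_le_n by auto
    then show "(if ranking I a j = i then ctr I j else 0) = (if j = k then ctr I j else 0)" by simp
  qed
  also have "\<dots> = ctr I (slot_of I i a)"
    using slot_of_ranked[OF assms(1) k(1)] k ctr_0 by auto
  finally show ?thesis by simp
qed

lemma measurable_ctr_slot:
  assumes "i \<in> bidders I"
  shows "(\<lambda>a. ctr I (slot_of I i a)) \<in> borel_measurable (profile_space (bidders I))"
proof -
  have "(\<lambda>a. \<Sum>j\<in>{1..m}. if ranking I a j = i then ctr I j else 0) \<in>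
      borel_measurable (profile_space (bidders I))"
  proof (intro borel_measurable_sum)
    fix j assume "j \<in> {1..m}"
    then have [measurable]: "(\<lambda>a. ranking I a j) \<in> measurable (profile_space (bidders I)) (count_space UNIV)"
      using m_le_n by (intro measurable_ranking) auto
    show "(\<lambda>a. if ranking I a j = i then ctr I j else 0) \<in> borel_measurable (profile_space (bidders I))"
      by measurable
  qed
  then show ?thesis
    by (rule measurable_cong[THEN iffD1, rotated]) (simp add: ctr_slot_eq assms)
qed

lemma measurable_threshold:
  assumes "j \<in> {1..n}"
  shows "threshold j \<in> borel_measurable (profile_space (bidders I))"
proof -
  have [measurable]: "(\<lambda>a. ranking I a j) \<in> measurable (profile_space (bidders I)) (count_space UNIV)"
    using assms by (rule measurable_ranking)
  \<comment> \<open>The coordinate being read depends on \<open>a\<close>; splitting by its holder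
    leaves fixed coordinates only.\<close>
  have "(\<lambda>a. \<Sum>i\<in>bidders I. if ranking I a j = i then a i else 0) \<in>
      borel_measurable (profile_space (bidders I))"
  proof (intro borel_measurable_sum)
    fix i assume "i \<in> bidders I"
    then have [measurable]: "(\<lambda>a. a i) \<in> borel_measurable (profile_space (bidders I))"
      by (rule measurable_component)
    show "(\<lambda>a. if ranking I a j = i then a i else 0) \<in> borel_measurable (profile_space (bidders I))"
      by measurable
  qed
  moreover have "(\<Sum>i\<in>bidders I. if ranking I a j = i then a i else 0) = a (ranking I a j)"
    if "a \<in> profiles" for a
    using ranking_in[OF that assms] finite_bidders by simp
  ultimately have "(\<lambda>a. a (ranking I a j)) \<in> borel_measurable (profile_space (bidders I))"
    by (rule measurable_cong[THEN iffD1, rotated])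
  then show ?thesis
    unfolding threshold_def by simp
qed

lemma measurable_upd:
  assumes "i \<in> bidders I"
  shows "(\<lambda>z. (snd z)(i := fst z)) \<in>
    measurable (bid_space \<Otimes>\<^sub>M profile_space (bidders I - {i})) (profile_space (bidders I))"
proof -
  have "(\<lambda>(f, y). f(i := y)) \<in> measurable (profile_space (bidders I - {i}) \<Otimes>\<^sub>M bid_space) (profile_space (insert i (bidders I - {i})))"
    unfolding profile_space_def by (rule measurable_add_dim)
  from measurable_compose[OF measurable_pair_swap' this] show ?thesis
    using assms by (simp add: case_prod_beta insert_absorb)
qed

lemma ctr_slot_le:
  assumes "a \<in> profiles" "i \<in> bidders I"
  shows "ctr I (slot_of I i a) \<le> (\<Sum>j\<in>{1..m}. ctr I j)"
  unfolding ctr_slot_eq[OF assms] using ctr_pos by (intro sum_mono) (auto intro: less_imp_le)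

end

section \<open>Expectations at an equilibrium\<close>

locale gsp_equilibrium = gsp_auction +
  fixes A :: "(nat \<Rightarrow> real) measure"
  assumes equilibrium: "coarse_correlated_equilibrium I A"
begin

lemma prob_space_A: "prob_space A" and sets_A [measurable_cong]: "sets A = sets (profile_space (bidders I))"
  using equilibrium by (auto simp: coarse_correlated_equilibrium_def distributions_def)

sublocale prob_space A by (rule prob_space_A)

lemma space_A: "space A = profiles"
  using sets_A by (rule sets_eq_imp_space_eq)

lemmas measurable_A = measurable_cong_sets[OF sets_A refl, THEN eqset_imp_iff, THEN iffD2]

lemma integrable_ctr_slot:
  assumes "i \<in> bidders I" and [measurable]: "g \<in> measurable A (profile_space (bidders I))"
  shows "integrable A (\<lambda>a. ctr I (slot_of I i (g a)))"
proof (rule integrable_const_bound[where B = "\<Sum>j\<in>{1..m}. ctr I j"])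
  have "g a \<in> profiles" if "a \<in> space A" for a
    using measurable_space[OF assms(2) that] .
  then show "AE a in A. norm (ctr I (slot_of I i (g a))) \<le> (\<Sum>j\<in>{1..m}. ctr I j)"
    using assms(1) ctr_slot_le ctr_slot_nonneg by (intro AE_I2) auto
  show "(\<lambda>a. ctr I (slot_of I i (g a))) \<in> borel_measurable A"
    using measurable_compose[OF assms(2) measurable_ctr_slot[OF assms(1)]] .
qed

abbreviation value_of :: "nat \<Rightarrow> real" where
  "value_of i \<equiv> click_value I i * (\<integral>a. ctr I (slot_of I i a) \<partial>A)"

lemma expect_valuation:
  assumes "i \<in> bidders I"
  shows "expect A (\<lambda>a. valuation I i (slot_of I i a)) = ereal (value_of i)"
proof -
  have "integrable A (\<lambda>a. ctr I (slot_of I i a))"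
    using integrable_ctr_slot[OF assms, of "\<lambda>a. a"] measurable_A by auto
  then show ?thesis
    unfolding valuation_def using click_value_nonneg[OF assms] assms
    by (subst expect_eq_integral) (auto simp: space_A ctr_slot_nonneg)
qed

lemma value_of_nonneg: "i \<in> bidders I \<Longrightarrow> 0 \<le> value_of i"
  using click_value_nonneg ctr_slot_nonneg
  by (auto intro!: mult_nonneg_nonneg Bochner_Integration.integral_nonneg simp: space_A)

section \<open>Randomized deviations\<close>

text \<open>Bid 0 costs nothing, so \<open>q\<close> scales down the expected payment of the fixed
  bid \<open>b\<close> and can bring it within the budget.\<close>

definition two_point :: "real \<Rightarrow> real \<Rightarrow> real measure" where
  "two_point q b = distr (measure_pmf (bernoulli_pmf q)) bid_space (\<lambda>x. if x then b else 0)"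

lemma two_point_measurable:
  "0 \<le> b \<Longrightarrow> (\<lambda>x. if x then b else 0) \<in> measurable (measure_pmf (bernoulli_pmf q)) bid_space"
  by (auto simp: space_bid_space)

lemma two_point_distribution:
  assumes "0 \<le> b"
  shows "two_point q b \<in> distributions bid_space"
  unfolding two_point_def distributions_def
  using measure_pmf.prob_space_distr[OF two_point_measurable[OF assms]] by auto

text \<open>Stated for nonnegative integrands because \<open>expect\<close> is a difference of two
  such integrals; it serves for payments and for both parts of the utility.\<close>

lemma nn_integral_two_point:
  assumes i: "i \<in> bidders I" and q: "0 \<le> q" "q \<le> 1" and b: "0 \<le> b"
    and h: "h \<in> borel_measurable (profile_space (bidders I))"
  shows "(\<integral>\<^sup>+z. h ((snd z)(i := fst z)) \<partial>(two_point q b \<Otimes>\<^sub>M marginal_others I i A)) =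
    ennreal q * (\<integral>\<^sup>+a. h (a(i := b)) \<partial>A) + ennreal (1 - q) * (\<integral>\<^sup>+a. h (a(i := 0)) \<partial>A)"
proof -
  let ?R = "\<lambda>a. restrict a (bidders I - {i})"
  have R: "?R \<in> measurable A (profile_space (bidders I - {i}))"
    unfolding profile_space_def
    by (rule measurable_A[unfolded profile_space_def]) (rule measurable_restrict_subset, auto)
  have "prob_space (marginal_others I i A)"
    unfolding marginal_others_def by (rule prob_space_distr[OF R])
  then interpret M: prob_space "marginal_others I i A" .
  have sets_M [measurable_cong]: "sets (marginal_others I i A) = sets (profile_space (bidders I - {i}))"
    by (simp add: marginal_others_def)
  have sets_D [measurable_cong]: "sets (two_point q b) = sets bid_space"
    by (simp add: two_point_def)
  have H: "(\<lambda>z. h ((snd z)(i := fst z))) \<in> borel_measurable (bid_space \<Otimes>\<^sub>M profile_space (bidders I - {i}))"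
    by (rule measurable_compose[OF measurable_upd[OF i] h])
  also have "borel_measurable (bid_space \<Otimes>\<^sub>M profile_space (bidders I - {i})) =
      borel_measurable (two_point q b \<Otimes>\<^sub>M marginal_others I i A)"
    by (intro measurable_cong_sets sets_pair_measure_cong) (simp_all add: sets_M sets_D)
  finally have H': "(\<lambda>z. h ((snd z)(i := fst z))) \<in> borel_measurable (two_point q b \<Otimes>\<^sub>M marginal_others I i A)" .
  \<comment> \<open>Coordinate \<open>i\<close> is overwritten before \<open>h\<close> sees it, so
    the marginal of the others may be replaced by \<open>A\<close> itself.\<close>
  have slice: "(\<integral>\<^sup>+a. h (a(i := y)) \<partial>marginal_others I i A) = (\<integral>\<^sup>+a. h (a(i := y)) \<partial>A)" if y: "0 \<le> y" for y
  proof -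
    have "(\<lambda>a. h (a(i := y))) \<in> borel_measurable (profile_space (bidders I - {i}))"
      using measurable_compose_Pair1[OF _ H, of y] y by (simp add: space_bid_space)
    then have "(\<integral>\<^sup>+a. h (a(i := y)) \<partial>marginal_others I i A) = (\<integral>\<^sup>+a. h ((?R a)(i := y)) \<partial>A)"
      unfolding marginal_others_def by (subst nn_integral_distr[OF R]) simp_all
    also have "\<dots> = (\<integral>\<^sup>+a. h (a(i := y)) \<partial>A)"
    proof (intro nn_integral_cong arg_cong[of _ _ h] ext)
      fix a x assume "a \<in> space A"
      then show "((?R a)(i := y)) x = (a(i := y)) x"
        by (auto simp: space_A space_profile_space PiE_iff extensional_def)
    qed
    finally show ?thesis .
  qed
  have slice_meas: "(\<lambda>y. \<integral>\<^sup>+a. h (a(i := y)) \<partial>marginal_others I i A) \<in> borel_measurable bid_space"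
    using M.borel_measurable_nn_integral_fst[OF H'] by (simp add: measurable_cong_sets[OF sets_D refl])
  have "(\<integral>\<^sup>+z. h ((snd z)(i := fst z)) \<partial>(two_point q b \<Otimes>\<^sub>M marginal_others I i A)) =
      (\<integral>\<^sup>+y. \<integral>\<^sup>+a. h (a(i := y)) \<partial>marginal_others I i A \<partial>two_point q b)"
    using M.nn_integral_fst[OF H'] by simp
  also have "\<dots> = (\<integral>\<^sup>+x. \<integral>\<^sup>+a. h (a(i := (if x then b else 0))) \<partial>marginal_others I i A \<partial>bernoulli_pmf q)"
    unfolding two_point_def using slice_meas by (subst nn_integral_distr[OF two_point_measurable[OF b]]) simp_all
  also have "\<dots> = (\<integral>\<^sup>+a. h (a(i := b)) \<partial>A) * ennreal q + (\<integral>\<^sup>+a. h (a(i := 0)) \<partial>A) * ennreal (1 - q)"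
    using q b by (simp add: slice)
  finally show ?thesis by (simp add: mult.commute)
qed

abbreviation dev_ctr :: "nat \<Rightarrow> real \<Rightarrow> real" where
  "dev_ctr i b \<equiv> (\<integral>a. ctr I (slot_of I i (a(i := b))) \<partial>A)"

lemma measurable_A_upd:
  assumes i: "i \<in> bidders I" and b: "0 \<le> b"
  shows "(\<lambda>a. a(i := b)) \<in> measurable A (profile_space (bidders I))"
proof (rule measurable_A)
  have "(\<lambda>a. restrict a (bidders I - {i})) \<in> measurable (profile_space (bidders I)) (profile_space (bidders I - {i}))"
    unfolding profile_space_def by (rule measurable_restrict_subset) auto
  moreover have "(\<lambda>z. z(i := b)) \<in> measurable (profile_space (bidders I - {i})) (profile_space (bidders I))"
    using measurable_compose_Pair1[OF _ measurable_upd[OF i], of b] b by (simp add: space_bid_space)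
  ultimately have "(\<lambda>a. (restrict a (bidders I - {i}))(i := b)) \<in> measurable (profile_space (bidders I)) (profile_space (bidders I))"
    by (rule measurable_compose)
  then show "(\<lambda>a. a(i := b)) \<in> measurable (profile_space (bidders I)) (profile_space (bidders I))"
    by (rule measurable_cong[THEN iffD1, rotated])
       (auto simp: space_profile_space PiE_iff extensional_def fun_eq_iff)
qed

lemma nn_integral_dev_ctr:
  assumes i: "i \<in> bidders I" and b: "0 \<le> b" and c: "0 \<le> c"
  shows "(\<integral>\<^sup>+a. ennreal (c * ctr I (slot_of I i (a(i := b)))) \<partial>A) = ennreal (c * dev_ctr i b)"
  using integrable_ctr_slot[OF i measurable_A_upd[OF i b]] ctr_slot_nonneg[OF profiles_upd[OF _ i b] i] c
  by (subst nn_integral_eq_integral) (auto simp: space_A)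

text \<open>Charging the full bid for every click overstates the payment of the deviation. This is
  safe both when checking the budget and when bounding the deviation utility from below. In
  equilibrium, utility is at most value since payments are nonnegative.\<close>

lemma two_point_deviation:
  assumes i: "i \<in> bidders I" and q: "0 \<le> q" "q \<le> 1" and b: "0 \<le> b" "b \<le> click_value I i"
    and budget: "ereal (q * (b * dev_ctr i b)) \<le> budget I i"
  shows "q * ((click_value I i - b) * dev_ctr i b) \<le> value_of i"
proof -
  let ?v = "click_value I i"
  let ?D = "two_point q b \<Otimes>\<^sub>M marginal_others I i A"
  let ?c = "\<lambda>a. ctr I (slot_of I i a)"
  have dev: "(snd z)(i := fst z) \<in> profiles" if "z \<in> space ?D" for z
  proof -
    have "fst z \<in> space bid_space" "snd z \<in> space (profile_space (bidders I - {i}))"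
      using that by (auto simp: space_pair_measure two_point_def marginal_others_def)
    then show ?thesis
      using i by (auto simp: space_bid_space space_profile_space PiE_iff extensional_def)
  qed
  note [measurable] = measurable_ctr_slot[OF i] measurable_component[OF i]
  have g_nonneg: "0 \<le> dev_ctr i b" "0 \<le> dev_ctr i 0"
    using ctr_slot_nonneg[OF profiles_upd[OF _ i] i] b by (auto intro!: Bochner_Integration.integral_nonneg simp: space_A)
  have "expect_dev I i A (two_point q b) (payment I i) =
      enn2ereal (\<integral>\<^sup>+z. ennreal (payment I i ((snd z)(i := fst z))) \<partial>?D)"
    unfolding expect_dev_def case_prod_beta using payment_nonneg[OF dev i]
    by (rule expect_nonneg_eq)
  also have "\<dots> \<le> enn2ereal (\<integral>\<^sup>+z. (\<lambda>a. ennreal (?c a * a i)) ((snd z)(i := fst z)) \<partial>?D)"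
    unfolding less_eq_ennreal.rep_eq[symmetric]
    using payment_le_bid[OF dev i] by (intro nn_integral_mono ennreal_leI)
  \<comment> \<open>The branch that bids 0 disappears because the integrand has the bid as a
    factor.\<close>
  also have "(\<integral>\<^sup>+z. (\<lambda>a. ennreal (?c a * a i)) ((snd z)(i := fst z)) \<partial>?D) =
      ennreal q * (\<integral>\<^sup>+a. ennreal (b * ?c (a(i := b))) \<partial>A)"
    by (subst nn_integral_two_point[OF i q b(1)]) (simp_all add: mult.commute)
  also have "\<dots> = ennreal (q * (b * dev_ctr i b))"
    unfolding nn_integral_dev_ctr[OF i b(1) b(1)] using q b g_nonneg by (simp add: ennreal_mult)
  also have "enn2ereal \<dots> = ereal (q * (b * dev_ctr i b))"
    using q b g_nonneg by simp
  also note budget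
  finally have "two_point q b \<in> feasible_deviations I i A"
    using two_point_distribution[OF b(1)] by (simp add: feasible_deviations_def)
  then have "expect_dev I i A (two_point q b) (utility I i) \<le> expect A (utility I i)"
    using equilibrium i by (auto simp: coarse_correlated_equilibrium_def)
  also have "\<dots> \<le> expect A (\<lambda>a. valuation I i (slot_of I i a))"
    using payment_nonneg[OF _ i] by (intro expect_mono) (auto simp: utility_def space_A)
  also have "\<dots> = ereal (value_of i)"
    by (rule expect_valuation[OF i])
  finally have upper: "expect_dev I i A (two_point q b) (utility I i) \<le> ereal (value_of i)" .
  let ?u = "\<lambda>a. (?v - a i) * ?c a"
  \<comment> \<open>The branch that bids 0 earns a nonnegative value, which is dropped.\<close>
  have "q * ((?v - b) * dev_ctr i b) \<le> q * ((?v - b) * dev_ctr i b) + (1 - q) * (?v * dev_ctr i 0)"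
    using q g_nonneg click_value_nonneg[OF i] by simp
  also have "ereal \<dots> = enn2ereal (ennreal q * ennreal ((?v - b) * dev_ctr i b) + ennreal (1 - q) * ennreal (?v * dev_ctr i 0))"
    using q b g_nonneg click_value_nonneg[OF i] by (simp flip: ennreal_mult ennreal_plus)
  also have "ennreal q * ennreal ((?v - b) * dev_ctr i b) + ennreal (1 - q) * ennreal (?v * dev_ctr i 0) =
      (\<integral>\<^sup>+z. (\<lambda>a. ennreal (?u a)) ((snd z)(i := fst z)) \<partial>?D)"
    using b click_value_nonneg[OF i]
    by (subst nn_integral_two_point[OF i q b(1)]) (simp_all add: nn_integral_dev_ctr[OF i])
  \<comment> \<open>Both possible bids are at most the value per click, so the negative part of
    \<open>?u\<close> integrates to 0; subtracting it gives the form of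
    \<open>expect\<close>.\<close>
  also have "enn2ereal \<dots> = enn2ereal \<dots> - enn2ereal (\<integral>\<^sup>+z. (\<lambda>a. ennreal (- ?u a)) ((snd z)(i := fst z)) \<partial>?D)"
  proof -
    have "ennreal (- ((?v - y) * ?c (a(i := y)))) = 0" if "a \<in> space A" "0 \<le> y" "y \<le> ?v" for y a
      using that ctr_slot_nonneg[OF profiles_upd[OF _ i] i] by (auto simp: space_A intro!: ennreal_neg)
    then have "(\<integral>\<^sup>+a. ennreal (- ((?v - y) * ?c (a(i := y)))) \<partial>A) = 0" if "0 \<le> y" "y \<le> ?v" for y
      using that by (simp cong: nn_integral_cong)
    from this[of b] this[of 0] show ?thesis
      using b click_value_nonneg[OF i]
      by (subst (2) nn_integral_two_point[OF i q b(1)]) (simp_all add: zero_ennreal.rep_eq)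
  qed
  also have "\<dots> \<le> expect_dev I i A (two_point q b) (utility I i)"
    unfolding expect_dev_def case_prod_beta expect_def[symmetric]
  proof (rule expect_mono)
    fix z assume "z \<in> space ?D"
    from payment_le_bid[OF dev[OF this] i]
    show "?u ((snd z)(i := fst z)) \<le> utility I i ((snd z)(i := fst z))"
      by (simp add: utility_def valuation_def algebra_simps)
  qed
  also note upper
  finally show ?thesis by (simp only: ereal_less_eq)
qed

text \<open>\<open>e\<close> is the clicks of the target lottery, \<open>g\<close> those of always
  bidding \<open>b\<close>, and \<open>G\<close> the clicks to be guaranteed. \<open>G\<close> is at
  most \<open>e\<close> since probabilities are at most 1, and at most \<open>g\<close> since
  \<open>b\<close> above the threshold wins slot \<open>j\<close> or better and the weights
  \<open>c\<close> sum to at most 1. Hence \<open>two_point_deviation\<close> applies with expected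
  clicks \<open>min g e\<close>.\<close>

lemma deviation_bound:
  assumes i: "i \<in> bidders I" and b: "0 \<le> b" "b \<le> click_value I i"
    and c: "\<And>j. j \<in> {1..m} \<Longrightarrow> 0 \<le> c j" "(\<Sum>j\<in>{1..m}. c j) \<le> 1"
    and budget: "ereal (click_value I i * (\<Sum>j\<in>{1..m}. c j * ctr I j)) \<le> budget I i"
  shows "(click_value I i - b) *
      (\<Sum>j\<in>{1..m}. c j * ctr I j * prob {a \<in> space A. threshold j a < b}) \<le> value_of i"
proof -
  let ?v = "click_value I i"
  define e where "e = (\<Sum>j\<in>{1..m}. c j * ctr I j)"
  define g where "g = dev_ctr i b"
  define G where "G = (\<Sum>j\<in>{1..m}. c j * ctr I j * prob {a \<in> space A. threshold j a < b})"
  have "0 \<le> e" unfolding e_def using c ctr_pos by (intro sum_nonneg mult_nonneg_nonneg) (auto intro: less_imp_le)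
  have "0 \<le> g" unfolding g_def
    using ctr_slot_nonneg[OF profiles_upd[OF _ i] i] b by (auto intro!: Bochner_Integration.integral_nonneg simp: space_A)
  have "G \<le> e"
    unfolding G_def e_def using c ctr_pos
    by (intro sum_mono mult_left_le mult_nonneg_nonneg) (auto intro: less_imp_le)
  have "ctr I j * prob {a \<in> space A. threshold j a < b} \<le> g" if j: "j \<in> {1..m}" for j
  proof -
    have [measurable]: "threshold j \<in> borel_measurable A"
      using measurable_A[OF measurable_threshold[of j]] j m_le_n by auto
    have "ctr I j * prob {a \<in> space A. threshold j a < b} =
        (\<integral>a. ctr I j * indicator {a \<in> space A. threshold j a < b} a \<partial>A)"
      by simp
    also have "\<dots> \<le> g"
      unfolding g_def
    proof (intro integral_mono integrable_ctr_slot i measurable_A_upd b)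
      show "integrable A (\<lambda>a. ctr I j * indicator {a \<in> space A. threshold j a < b} a)"
        by (auto simp: less_top[symmetric])
      fix a assume a: "a \<in> space A"
      show "ctr I j * indicator {a \<in> space A. threshold j a < b} a \<le> ctr I (slot_of I i (a(i := b)))"
      proof (cases "threshold j a < b")
        case True
        then have "slot_of I i (a(i := b)) \<in> {1..j}"
          using slot_of_above_threshold[OF _ i j] a by (simp add: space_A)
        then show ?thesis using True a ctr_antimono[of "slot_of I i (a(i := b))" j] j by simp
      next
        case False
        then show ?thesis
          using ctr_slot_nonneg[OF profiles_upd[OF _ i b(1)] i] a by (simp add: space_A)
      qed
    qed
    finally show ?thesis .
  qed
  then have "G \<le> (\<Sum>j\<in>{1..m}. c j * g)"
    unfolding G_def mult.assoc using c by (intro sum_mono mult_left_mono) auto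
  also have "\<dots> = (\<Sum>j\<in>{1..m}. c j) * g"
    by (simp add: sum_distrib_right)
  also have "\<dots> \<le> g"
    using mult_right_mono[OF c(2) \<open>0 \<le> g\<close>] by simp
  finally have "G \<le> g" .
  \<comment> \<open>Chosen so that \<open>q * g = min g e\<close>: at most \<open>e\<close> keeps
    the cost within the budget, and at least \<open>G\<close> preserves the guarantee.\<close>
  define q where "q = (if g \<le> e then 1 else e / g)"
  have q: "0 \<le> q" "q \<le> 1" "q * g = min g e"
    using \<open>0 \<le> e\<close> \<open>0 \<le> g\<close> by (auto simp: q_def)
  have "q * (b * g) \<le> ?v * e"
    using mult_mono[of b ?v "q * g" e] b q \<open>0 \<le> e\<close> \<open>0 \<le> g\<close> by (simp add: mult.left_commute)
  then have "ereal (q * (b * g)) \<le> budget I i"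
    using budget by (simp add: e_def) (metis ereal_less_eq(3) order_trans)
  then have "q * ((?v - b) * g) \<le> value_of i"
    unfolding g_def using two_point_deviation[OF i q(1,2) b] by simp
  moreover have "(?v - b) * G \<le> (?v - b) * (q * g)"
    using b q \<open>G \<le> g\<close> \<open>G \<le> e\<close> by (intro mult_left_mono) auto
  ultimately show ?thesis
    unfolding G_def by (simp add: mult.left_commute)
qed

section \<open>The inequality for a single bidder\<close>

lemma measurable_threshold_A: "j \<in> {1..m} \<Longrightarrow> threshold j \<in> borel_measurable A"
  using measurable_A[OF measurable_threshold[of j]] m_le_n by auto

lemma liquid_value:
  assumes i: "i \<in> bidders I"
  obtains L where "min (ereal (value_of i)) (budget I i) = ereal L" "0 \<le> L" "L \<le> value_of i"
proof (cases "ereal (value_of i) \<le> budget I i")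
  case True
  then show ?thesis using that[of "value_of i"] value_of_nonneg[OF i] by (simp add: min_def)
next
  case False
  then obtain r where "budget I i = ereal r"
    using budget_pos[OF i] by (cases "budget I i") auto
  then show ?thesis using that[of r] False budget_pos[OF i] by (simp add: min_def)
qed

text \<open>If \<open>O'\<close> is at most \<open>L\<close>, it suffices that
  \<open>1 - 1 / \<Lambda> \<le> 1 \<le> ln \<Lambda>\<close>, which is where
  \<open>exp 1 \<le> \<Lambda>\<close> enters. Otherwise \<open>L\<close> lies below
  \<open>O'\<close> and hence below the budget, so \<open>L\<close> is the uncapped value and the
  deviation bounds can be integrated.\<close>

lemma bidder_bound:
  assumes i: "i \<in> bidders I"
    and p: "\<And>j. j \<in> {1..m} \<Longrightarrow> 0 \<le> p j" "(\<Sum>j\<in>{1..m}. p j) \<le> 1"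
    and opt: "0 \<le> O'" "O' \<le> click_value I i * (\<Sum>j\<in>{1..m}. p j * ctr I j)" "ereal O' \<le> budget I i"
    and L: "min (ereal (value_of i)) (budget I i) = ereal L"
    and integrable: "\<And>j. j \<in> {1..m} \<Longrightarrow> integrable A (threshold j)"
    and \<Lambda>: "exp 1 \<le> \<Lambda>"
  shows "(1 - 1 / \<Lambda>) * O' \<le> ln \<Lambda> * L + (\<Sum>j\<in>{1..m}. p j * (ctr I j * (\<integral>a. threshold j a \<partial>A)))"
proof -
  let ?v = "click_value I i"
  let ?t = "\<lambda>j. \<integral>a. threshold j a \<partial>A"
  have \<Lambda>': "1 < \<Lambda>" "1 \<le> ln \<Lambda>"
    using \<Lambda> less_le_trans[OF _ \<Lambda>, of 1] less_le_trans[OF exp_gt_zero \<Lambda>] by (simp_all add: ln_ge_iff)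
  have t: "0 \<le> ?t j" if "j \<in> {1..m}" for j
    using threshold_nonneg that by (auto intro!: Bochner_Integration.integral_nonneg simp: space_A)
  have "0 \<le> L" using liquid_value[OF i] L by auto
  have pt: "0 \<le> (\<Sum>j\<in>{1..m}. p j * (ctr I j * ?t j))"
    using p t ctr_pos by (intro sum_nonneg mult_nonneg_nonneg) (auto intro: less_imp_le)
  show ?thesis
  proof (cases "O' \<le> L")
    case True
    have "(1 - 1 / \<Lambda>) * O' \<le> 1 * L" using True opt \<Lambda>' by (intro mult_mono) auto
    also have "\<dots> \<le> ln \<Lambda> * L" using \<Lambda>' \<open>0 \<le> L\<close> by (intro mult_right_mono) auto
    finally show ?thesis using pt by linarith
  next
    case False
    then have "ereal L \<noteq> budget I i" using opt(3) by (metis ereal_less_eq(3))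
    then have L_eq: "L = value_of i" using L by (simp add: min_def split: if_splits)
    have "0 < ?v * (\<Sum>j\<in>{1..m}. p j * ctr I j)" using False opt \<open>0 \<le> L\<close> by linarith
    then have pos: "0 < ?v" "0 < (\<Sum>j\<in>{1..m}. p j * ctr I j)"
      using click_value_nonneg[OF i] by (auto simp: zero_less_mult_iff)
    \<comment> \<open>scales the target lottery down so that its expected value is exactly \<open>O'\<close>\<close>
    define s where "s = O' / (?v * (\<Sum>j\<in>{1..m}. p j * ctr I j))"
    have s: "0 \<le> s" "s \<le> 1" using opt pos by (auto simp: s_def)
    have s_eq: "?v * (\<Sum>j\<in>{1..m}. s * p j * ctr I j) = O'"
      unfolding mult.assoc sum_distrib_left[symmetric] using pos by (simp add: s_def)
    \<comment> \<open>This upper limit makes \<open>?v / (?v - T)\<close> equal to \<Lambda>, so the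
      integration yields \<open>ln \<Lambda>\<close>.\<close>
    define T where "T = (1 - 1 / \<Lambda>) * ?v"
    have T: "0 \<le> T" "T < ?v" "?v / (?v - T) = \<Lambda>"
      using pos \<Lambda>' by (auto simp: T_def field_simps)
    have "(\<Sum>j\<in>{1..m}. s * p j * ctr I j * (T - ?t j)) \<le> value_of i * ln (?v / (?v - T))"
    proof (rule sum_expectation_le_of_pointwise_bound[OF prob_space_A])
      fix b assume b: "0 \<le> b" "b \<le> T"
      show "(?v - b) * (\<Sum>j\<in>{1..m}. s * p j * ctr I j * prob {a \<in> space A. threshold j a < b}) \<le> value_of i"
      proof (rule deviation_bound[OF i])
        show "(\<Sum>j\<in>{1..m}. s * p j) \<le> 1"
          unfolding sum_distrib_left[symmetric] using s p by (intro mult_le_one sum_nonneg) auto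
        show "ereal (?v * (\<Sum>j\<in>{1..m}. s * p j * ctr I j)) \<le> budget I i"
          unfolding s_eq by (rule opt(3))
      qed (use b T s p in auto)
    next
      show "0 \<le> s * p j * ctr I j" if "j \<in> {1..m}" for j
        using s p that ctr_pos[OF that] by auto
    qed (use T value_of_nonneg[OF i] integrable threshold_nonneg in \<open>auto simp: space_A\<close>)
    also have "value_of i * ln (?v / (?v - T)) = ln \<Lambda> * L"
      by (simp add: T L_eq)
    also have "(\<Sum>j\<in>{1..m}. s * p j * ctr I j * (T - ?t j)) =
        (\<Sum>j\<in>{1..m}. s * p j * ctr I j) * T - (\<Sum>j\<in>{1..m}. s * (p j * (ctr I j * ?t j)))"
      unfolding sum_distrib_right sum_subtractf[symmetric]
      by (intro sum.cong) (simp_all add: algebra_simps)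
    also have "(\<Sum>j\<in>{1..m}. s * p j * ctr I j) * T = (1 - 1 / \<Lambda>) * O'"
      unfolding T_def by (subst s_eq[symmetric]) simp
    finally have "(1 - 1 / \<Lambda>) * O' \<le> ln \<Lambda> * L + s * (\<Sum>j\<in>{1..m}. p j * (ctr I j * ?t j))"
      by (simp add: sum_distrib_left)
    also have "s * (\<Sum>j\<in>{1..m}. p j * (ctr I j * ?t j)) \<le> (\<Sum>j\<in>{1..m}. p j * (ctr I j * ?t j))"
      using mult_right_mono[OF s(2) pt] by simp
    finally show ?thesis by simp
  qed
qed

section \<open>No overbidding bounds the thresholds\<close>

text \<open>By \<open>willingness_ge\<close>, the holder of slot \<open>k < n\<close> has
  willingness at least \<open>ctr I k * threshold k a\<close>; for \<open>k = n\<close> the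
  threshold is 0. Summed over bidders this is a sum over slots, and its finite expectation also
  yields integrability.\<close>

lemma threshold_le_liquid_welfare:
  assumes nob: "nob_feasible I A" and LW: "liquid_welfare I A = ereal LW" "0 \<le> LW"
  shows "j \<in> {1..m} \<Longrightarrow> integrable A (threshold j)"
    and "(\<Sum>j\<in>{1..m}. ctr I j * (\<integral>a. threshold j a \<partial>A)) \<le> LW"
proof -
  \<comment> \<open>a measurable minorant of the willingness, whose own measurability is unclear\<close>
  define w where "w i a = (\<Sum>j\<in>{1..m}. if ranking I a j = i then ctr I j * threshold j a else 0)" for i a
  have w_meas: "w i \<in> borel_measurable A" for i
    unfolding w_def
  proof (intro borel_measurable_sum)
    fix j assume j: "j \<in> {1..m}"
    then have [measurable]: "(\<lambda>a. ranking I a j) \<in> measurable A (count_space UNIV)"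
      using m_le_n by (intro measurable_A measurable_ranking) auto
    note measurable_threshold_A[OF j, measurable]
    show "(\<lambda>a. if ranking I a j = i then ctr I j * threshold j a else 0) \<in> borel_measurable A"
      by measurable
  qed
  have w_le: "w i a \<le> willingness I i a" "0 \<le> w i a" "0 \<le> willingness I i a"
    if i: "i \<in> bidders I" and a: "a \<in> profiles" for i a
  proof -
    obtain k where k: "k \<in> {1..n}" "ranking I a k = i"
      using ranking_surj[OF a i] .
    have "w i a = (\<Sum>j\<in>{1..m}. if j = k then ctr I j * threshold j a else 0)"
      unfolding w_def
    proof (intro sum.cong refl)
      fix j assume "j \<in> {1..m}"
      then have "ranking I a j = i \<longleftrightarrow> j = k"
        using ranking_inj[OF a, of j k] k m_le_n by auto
      then show "(if ranking I a j = i then ctr I j * threshold j a else 0) =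
        (if j = k then ctr I j * threshold j a else 0)" by simp
    qed
    also have "\<dots> = (if k \<le> m then ctr I k * threshold k a else 0)"
      using k by simp
    finally have w: "w i a = (if k \<le> m then ctr I k * threshold k a else 0)" .
    show "0 \<le> willingness I i a" by (rule willingness_ge(1)[OF a i k])
    then show "w i a \<le> willingness I i a"
      using willingness_ge(2)[OF a i k] k w by (auto simp: threshold_def)
    show "0 \<le> w i a"
      unfolding w using ctr_nonneg[of k] threshold_nonneg[OF a, of k] k by auto
  qed
  \<comment> \<open>Each slot is held by exactly one bidder, so exchanging the sums leaves one term
    per slot.\<close>
  have sum_w: "(\<Sum>i\<in>bidders I. w i a) = (\<Sum>j\<in>{1..m}. ctr I j * threshold j a)" if "a \<in> profiles" for a
  proof -
    have "(\<Sum>i\<in>bidders I. w i a) =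
        (\<Sum>j\<in>{1..m}. \<Sum>i\<in>bidders I. if ranking I a j = i then ctr I j * threshold j a else 0)"
      unfolding w_def by (rule sum.swap)
    also have "\<dots> = (\<Sum>j\<in>{1..m}. ctr I j * threshold j a)"
      using ranking_in[OF that] m_le_n finite_bidders by (intro sum.cong) auto
    finally show ?thesis .
  qed
  have "enn2ereal (\<Sum>i\<in>bidders I. \<integral>\<^sup>+a. ennreal (w i a) \<partial>A) = (\<Sum>i\<in>bidders I. expect A (w i))"
  proof -
    have "expect A (w i) = enn2ereal (\<integral>\<^sup>+a. ennreal (w i a) \<partial>A)" if "i \<in> bidders I" for i
      using w_le(2)[OF that] by (intro expect_nonneg_eq) (simp add: space_A)
    then show ?thesis by simp
  qed
  \<comment> \<open>\<open>expect_mono\<close> holds for arbitrary functions; measurability enters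
    only for \<open>w\<close>, when sum and integral are exchanged.\<close>
  also have "\<dots> \<le> (\<Sum>i\<in>bidders I. expect A (willingness I i))"
    using w_le by (intro sum_mono expect_mono) (auto simp: space_A)
  also have "\<dots> \<le> ereal LW"
    using nob LW by (simp add: nob_feasible_def)
  also have "ereal LW = enn2ereal (ennreal LW)"
    using LW by simp
  finally have "(\<Sum>i\<in>bidders I. \<integral>\<^sup>+a. ennreal (w i a) \<partial>A) \<le> ennreal LW"
    by (simp only: less_eq_ennreal.rep_eq)
  also have "(\<Sum>i\<in>bidders I. \<integral>\<^sup>+a. ennreal (w i a) \<partial>A) = (\<integral>\<^sup>+a. (\<Sum>i\<in>bidders I. ennreal (w i a)) \<partial>A)"
    using w_meas by (intro nn_integral_sum[symmetric]) auto
  also have "\<dots> = (\<integral>\<^sup>+a. ennreal (\<Sum>j\<in>{1..m}. ctr I j * threshold j a) \<partial>A)"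
    using w_le sum_w by (intro nn_integral_cong) (simp add: space_A)
  finally have le: "(\<integral>\<^sup>+a. ennreal (\<Sum>j\<in>{1..m}. ctr I j * threshold j a) \<partial>A) \<le> ennreal LW" .
  have nonneg: "0 \<le> ctr I j * threshold j a" if "j \<in> {1..m}" "a \<in> space A" for j a
    using threshold_nonneg[of a j] ctr_pos[of j] that by (auto simp: space_A)
  show int: "integrable A (threshold j)" if j: "j \<in> {1..m}" for j
  proof -
    have "integrable A (\<lambda>a. ctr I j * threshold j a)"
    proof (rule integrableI_bounded)
      show "(\<lambda>a. ctr I j * threshold j a) \<in> borel_measurable A"
        using measurable_threshold_A[OF j] by simp
      have "(\<integral>\<^sup>+a. ennreal (norm (ctr I j * threshold j a)) \<partial>A) \<le>
          (\<integral>\<^sup>+a. ennreal (\<Sum>j\<in>{1..m}. ctr I j * threshold j a) \<partial>A)"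
        using nonneg j by (intro nn_integral_mono ennreal_leI) (auto intro!: member_le_sum)
      also note le
      finally show "(\<integral>\<^sup>+a. ennreal (norm (ctr I j * threshold j a)) \<partial>A) < \<infinity>"
        by (auto simp: top_unique less_top[symmetric])
    qed
    then show ?thesis using ctr_pos[OF j] by simp
  qed
  have "(\<integral>\<^sup>+a. ennreal (\<Sum>j\<in>{1..m}. ctr I j * threshold j a) \<partial>A) =
      ennreal (\<integral>a. (\<Sum>j\<in>{1..m}. ctr I j * threshold j a) \<partial>A)"
    using int nonneg by (intro nn_integral_eq_integral) (auto intro!: AE_I2 sum_nonneg)
  also have "(\<integral>a. (\<Sum>j\<in>{1..m}. ctr I j * threshold j a) \<partial>A) = (\<Sum>j\<in>{1..m}. ctr I j * (\<integral>a. threshold j a \<partial>A))"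
    using int by simp
  finally show "(\<Sum>j\<in>{1..m}. ctr I j * (\<integral>a. threshold j a \<partial>A)) \<le> LW"
    using le LW by (simp add: ennreal_le_iff)
qed

section \<open>Lotteries over allocations and the price of anarchy\<close>

lemma liquid_welfare_finite:
  obtains L where "liquid_welfare I A = ereal (\<Sum>i\<in>bidders I. L i)"
    and "\<And>i. i \<in> bidders I \<Longrightarrow> min (ereal (value_of i)) (budget I i) = ereal (L i)"
    and "\<And>i. i \<in> bidders I \<Longrightarrow> 0 \<le> L i"
proof -
  have "\<forall>i\<in>bidders I. \<exists>L. min (ereal (value_of i)) (budget I i) = ereal L \<and> 0 \<le> L"
    using liquid_value by metis
  then obtain L where L: "\<And>i. i \<in> bidders I \<Longrightarrow> min (ereal (value_of i)) (budget I i) = ereal (L i) \<and> 0 \<le> L i"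
    by metis
  have "liquid_welfare I A = (\<Sum>i\<in>bidders I. ereal (L i))"
    unfolding liquid_welfare_def using L by (intro sum.cong) (auto simp: expect_valuation)
  then show ?thesis using that[of L] L by simp
qed

text \<open>The events counted are disjoint: across bidders by feasibility, which lets only slot 0
  be shared, and across slots because an allocation gives each bidder one value.\<close>

lemma slot_probability:
  assumes "set_pmf p \<subseteq> feasible_allocations I"
  shows "j \<noteq> 0 \<Longrightarrow> (\<Sum>i\<in>bidders I. measure_pmf.prob p {x. x i = j}) \<le> 1"
    and "i \<in> bidders I \<Longrightarrow> (\<Sum>j\<in>{1..m}. measure_pmf.prob p {x. x i = j}) \<le> 1"
    and "i \<in> bidders I \<Longrightarrow> expect (measure_pmf p) (\<lambda>x. valuation I i (x i)) =
      ereal (click_value I i * (\<Sum>j\<in>{1..m}. measure_pmf.prob p {x. x i = j} * ctr I j))"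
proof -
  \<comment> \<open>Feasibility is known on the support only, so the events are cut down to it
    before disjointness is used.\<close>
  let ?S = "\<lambda>i j. {x \<in> set_pmf p. x i = j}"
  have S: "measure_pmf.prob p {x. x i = j} = measure_pmf.prob p (?S i j)" for i j
    by (rule measure_pmf.finite_measure_eq_AE) (auto simp: AE_measure_pmf_iff)
  show "(\<Sum>i\<in>bidders I. measure_pmf.prob p {x. x i = j}) \<le> 1" if "j \<noteq> 0"
  proof -
    have "(\<Sum>i\<in>bidders I. measure_pmf.prob p (?S i j)) = measure_pmf.prob p (\<Union>i\<in>bidders I. ?S i j)"
      using assms that finite_bidders
      by (intro measure_pmf.finite_measure_finite_Union[symmetric])
         (fastforce simp: disjoint_family_on_def feasible_allocations_def)+
    then show ?thesis by (simp add: S)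
  qed
  show "(\<Sum>j\<in>{1..m}. measure_pmf.prob p {x. x i = j}) \<le> 1"
  proof -
    have "(\<Sum>j\<in>{1..m}. measure_pmf.prob p {x. x i = j}) = measure_pmf.prob p (\<Union>j\<in>{1..m}. {x. x i = j})"
      by (intro measure_pmf.finite_measure_finite_Union[symmetric]) (auto simp: disjoint_family_on_def)
    then show ?thesis by simp
  qed
  show "expect (measure_pmf p) (\<lambda>x. valuation I i (x i)) =
      ereal (click_value I i * (\<Sum>j\<in>{1..m}. measure_pmf.prob p {x. x i = j} * ctr I j))"
    if i: "i \<in> bidders I"
  proof -
    \<comment> \<open>Off the support \<open>x i\<close> may exceed \<open>m\<close>, where
      \<open>ctr\<close> is unconstrained. \<open>f\<close> agrees with the valuation on the support
      and is nonnegative everywhere.\<close>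
    define f where "f x = click_value I i * (\<Sum>j\<in>{1..m}. indicator {x. x i = j} x * ctr I j)" for x :: "nat \<Rightarrow> nat"
    have f: "valuation I i (x i) = f x" if "x \<in> set_pmf p" for x
    proof -
      have "x i \<le> m" using assms that i by (auto simp: feasible_allocations_def PiE_iff)
      then have "ctr I (x i) = (if x i \<in> {1..m} then ctr I (x i) else 0)"
        using ctr_0 by (cases "x i = 0") auto
      also have "\<dots> = (\<Sum>j\<in>{1..m}. if j = x i then ctr I j else 0)"
        by (rule sum.delta[symmetric]) simp
      also have "\<dots> = (\<Sum>j\<in>{1..m}. indicator {x. x i = j} x * ctr I j)"
        by (intro sum.cong) auto
      finally show ?thesis
        by (simp add: f_def valuation_def)
    qed
    have int: "integrable (measure_pmf p) (\<lambda>x. indicator {x. x i = j} x * ctr I j)" for j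
      by (intro integrable_mult_left integrable_real_indicator)
         (auto simp: measure_pmf.emeasure_eq_measure)
    have "expect (measure_pmf p) (\<lambda>x. valuation I i (x i)) = expect (measure_pmf p) f"
      unfolding expect_def using f
      by (intro arg_cong2[where f = minus] arg_cong[where f = enn2ereal] nn_integral_cong_AE)
         (auto simp: AE_measure_pmf_iff)
    also have "\<dots> = ereal (\<integral>x. f x \<partial>measure_pmf p)"
    proof (rule expect_eq_integral)
      show "integrable (measure_pmf p) f"
        unfolding f_def by (intro integrable_mult_right Bochner_Integration.integrable_sum int)
      show "0 \<le> f x" for x
        unfolding f_def using click_value_nonneg[OF i] ctr_pos
        by (intro mult_nonneg_nonneg sum_nonneg) (auto intro: less_imp_le)
    qed
    also have "(\<integral>x. f x \<partial>measure_pmf p) =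
        click_value I i * (\<Sum>j\<in>{1..m}. measure_pmf.prob p {x. x i = j} * ctr I j)"
      unfolding f_def integral_mult_right_zero Bochner_Integration.integral_sum[OF int] by simp
    finally show ?thesis .
  qed
qed

text \<open>\<open>bidder_bound\<close> is summed with the slot probabilities of an arbitrary
  lottery. As \<open>1 + ln \<Lambda> = \<Lambda> - 1\<close> and
  \<open>1 - 1 / \<Lambda> = (\<Lambda> - 1) / \<Lambda>\<close>, the factor
  \<open>\<Lambda> - 1\<close> cancels and \<Lambda> remains.\<close>

lemma opt_le_liquid_welfare:
  assumes nob: "nob_feasible I A" and \<Lambda>: "exp 1 \<le> \<Lambda>" "ln \<Lambda> = \<Lambda> - 2"
  shows "opt_liquid_welfare I \<le> ereal \<Lambda> * liquid_welfare I A"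
  unfolding opt_liquid_welfare_def
proof (rule SUP_least, clarify)
  fix p assume p: "set_pmf p \<subseteq> feasible_allocations I"
  obtain L where LW: "liquid_welfare I A = ereal (\<Sum>i\<in>bidders I. L i)"
    and L: "\<And>i. i \<in> bidders I \<Longrightarrow> min (ereal (value_of i)) (budget I i) = ereal (L i)"
    and L0: "\<And>i. i \<in> bidders I \<Longrightarrow> 0 \<le> L i"
    using liquid_welfare_finite by metis
  define P where "P i j = measure_pmf.prob p {x. x i = j}" for i j
  define V where "V i = click_value I i * (\<Sum>j\<in>{1..m}. P i j * ctr I j)" for i
  define t where "t j = ctr I j * (\<integral>a. threshold j a \<partial>A)" for j
  note thr = threshold_le_liquid_welfare[OF nob LW sum_nonneg[OF L0]]
  have t0: "0 \<le> t j" if "j \<in> {1..m}" for j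
    using threshold_nonneg ctr_pos[OF that] that
    by (auto simp: t_def space_A intro!: mult_nonneg_nonneg Bochner_Integration.integral_nonneg)
  have V0: "0 \<le> V i" if "i \<in> bidders I" for i
    unfolding V_def P_def using click_value_nonneg[OF that] ctr_pos
    by (intro mult_nonneg_nonneg sum_nonneg) (auto intro: less_imp_le)
  have "\<exists>z. min (ereal (V i)) (budget I i) = ereal z \<and> 0 \<le> z" if i: "i \<in> bidders I" for i
    using V0[OF i] budget_pos[OF i] by (cases "budget I i") (auto simp: min_def)
  then obtain Z where Z: "\<And>i. i \<in> bidders I \<Longrightarrow> min (ereal (V i)) (budget I i) = ereal (Z i) \<and> 0 \<le> Z i"
    by metis
  have "(1 - 1 / \<Lambda>) * Z i \<le> ln \<Lambda> * L i + (\<Sum>j\<in>{1..m}. P i j * t j)" if i: "i \<in> bidders I" for i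
    unfolding t_def
  proof (rule bidder_bound[OF i])
    have "ereal (Z i) \<le> ereal (V i)" "ereal (Z i) \<le> budget I i"
      using Z[OF i] by (metis min.cobounded1, metis min.cobounded2)
    then show "Z i \<le> click_value I i * (\<Sum>j\<in>{1..m}. P i j * ctr I j)" "ereal (Z i) \<le> budget I i"
      by (simp_all add: V_def)
  qed (use Z[OF i] L[OF i] thr(1) slot_probability(2)[OF p i] \<Lambda> in \<open>auto simp: P_def\<close>)
  then have "(\<Sum>i\<in>bidders I. (1 - 1 / \<Lambda>) * Z i) \<le> (\<Sum>i\<in>bidders I. ln \<Lambda> * L i + (\<Sum>j\<in>{1..m}. P i j * t j))"
    by (rule sum_mono)
  also have "\<dots> = ln \<Lambda> * (\<Sum>i\<in>bidders I. L i) + (\<Sum>j\<in>{1..m}. (\<Sum>i\<in>bidders I. P i j) * t j)"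
    unfolding sum.distrib sum_distrib_left[symmetric] sum_distrib_right
    by (subst sum.swap) (rule refl)
  \<comment> \<open>Each slot is assigned with total probability at most 1, so its price is charged
    at most once.\<close>
  also have "(\<Sum>j\<in>{1..m}. (\<Sum>i\<in>bidders I. P i j) * t j) \<le> (\<Sum>j\<in>{1..m}. 1 * t j)"
    unfolding P_def using t0 slot_probability(1)[OF p] by (intro sum_mono mult_right_mono) auto
  also have "\<dots> \<le> (\<Sum>i\<in>bidders I. L i)"
    using thr(2) by (simp add: t_def)
  finally have "(1 - 1 / \<Lambda>) * (\<Sum>i\<in>bidders I. Z i) \<le>
      (\<Lambda> - 2) * (\<Sum>i\<in>bidders I. L i) + (\<Sum>i\<in>bidders I. L i)"
    unfolding sum_distrib_left[symmetric] \<Lambda>(2) by simp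
  also have "\<dots> = (\<Lambda> - 1) * (\<Sum>i\<in>bidders I. L i)"
    unfolding left_diff_distrib by simp
  finally have "(1 - 1 / \<Lambda>) * (\<Sum>i\<in>bidders I. Z i) \<le> (\<Lambda> - 1) * (\<Sum>i\<in>bidders I. L i)" .
  moreover have "1 < \<Lambda>" using \<Lambda>(1) less_le_trans[OF _ \<Lambda>(1), of 1] by simp
  moreover have "1 - 1 / \<Lambda> = (\<Lambda> - 1) / \<Lambda>" using \<open>1 < \<Lambda>\<close> by (simp add: field_simps)
  ultimately have "(\<Lambda> - 1) * (\<Sum>i\<in>bidders I. Z i) \<le> (\<Lambda> - 1) * (\<Lambda> * (\<Sum>i\<in>bidders I. L i))"
    by (simp add: pos_divide_le_eq mult_ac)
  then have "(\<Sum>i\<in>bidders I. Z i) \<le> \<Lambda> * (\<Sum>i\<in>bidders I. L i)"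
    using \<open>1 < \<Lambda>\<close> by simp
  moreover have "(\<Sum>i\<in>bidders I. min (expect (measure_pmf p) (\<lambda>x. valuation I i (x i))) (budget I i)) =
      ereal (\<Sum>i\<in>bidders I. Z i)"
    unfolding sum_ereal[symmetric] using Z slot_probability(3)[OF p]
    by (intro sum.cong) (auto simp: V_def P_def)
  ultimately show "(\<Sum>i\<in>bidders I. min (expect (measure_pmf p) (\<lambda>x. valuation I i (x i))) (budget I i))
      \<le> ereal \<Lambda> * liquid_welfare I A"
    by (simp add: LW)
qed

end

theorem theorem6p3:
  "gsp_price_of_anarchy \<le> ereal \<bar>lambert_Wm1 (- exp (- 2))\<bar> \<and>
   \<bar>\<bar>lambert_Wm1 (- exp (- 2))\<bar> - 3.146\<bar> \<le> 0.0005 \<and>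
   (\<forall>I A. gsp_instance I \<and> coarse_correlated_equilibrium I A \<and> nob_feasible I A \<longrightarrow>
      opt_liquid_welfare I \<le> ereal \<bar>lambert_Wm1 (- exp (- 2))\<bar> * liquid_welfare I A)"
proof -
  obtain \<Lambda> where W: "lambert_Wm1 (- exp (- 2)) = - \<Lambda>" and \<Lambda>: "3.1455 \<le> \<Lambda>" "\<Lambda> \<le> 3.1465" "ln \<Lambda> = \<Lambda> - 2"
    using lambert_Wm1_bounds .
  have "1 \<le> ln \<Lambda>" using \<Lambda> by simp
  then have e: "exp 1 \<le> \<Lambda>" using \<Lambda> by (subst (asm) ln_ge_iff) auto
  have abs: "\<bar>- \<Lambda>\<bar> = \<Lambda>" using \<Lambda> by simp
  have opt: "opt_liquid_welfare I \<le> ereal \<Lambda> * liquid_welfare I A"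
    if "gsp_instance I" "coarse_correlated_equilibrium I A" "nob_feasible I A" for I A
  proof -
    interpret gsp_equilibrium I A
      using that by unfold_locales
    show ?thesis using opt_le_liquid_welfare that(3) e \<Lambda>(3) by blast
  qed
  have "opt_liquid_welfare I / liquid_welfare I A \<le> ereal \<Lambda>"
    if "gsp_instance I" "coarse_correlated_equilibrium I A" "nob_feasible I A" for I A
  proof -
    interpret gsp_equilibrium I A
      using that by unfold_locales
    obtain L where L: "liquid_welfare I A = ereal (\<Sum>i\<in>bidders I. L i)" "\<And>i. i \<in> bidders I \<Longrightarrow> 0 \<le> L i"
      using liquid_welfare_finite by metis
    define r where "r = (\<Sum>i\<in>bidders I. L i)"
    have "0 \<le> r" unfolding r_def by (rule sum_nonneg) (rule L(2))
    have opt': "opt_liquid_welfare I \<le> ereal (\<Lambda> * r)"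
      using opt[OF that] L(1) by (simp add: r_def)
    have "opt_liquid_welfare I / ereal r \<le> ereal \<Lambda>"
    \<comment> \<open>If the liquid welfare is 0, the product bound forces the optimum to be at most
      0, which excludes the quotient \<infinity>.\<close>
    proof (cases "r = 0")
      case True
      then show ?thesis
        using opt' \<Lambda> by (cases "opt_liquid_welfare I") (auto simp: divide_ereal_def)
    next
      case False
      then show ?thesis
        using opt' \<open>0 \<le> r\<close> by (simp add: ereal_divide_le_pos mult.commute)
    qed
    then show ?thesis by (simp add: L(1) r_def)
  qed
  then have "gsp_price_of_anarchy \<le> ereal \<Lambda>"
    unfolding gsp_price_of_anarchy_def by (intro Sup_least) blast
  moreover have "\<bar>\<Lambda> - 3.146\<bar> \<le> 0.0005"
    using \<Lambda> unfolding abs_le_iff by simp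
  ultimately show ?thesis
    unfolding W abs using opt by blast
qed

end
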